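(* Let $p$ be a positive integer. Suppose that $\Lambda_0>1$ and $\Lambda_1,\dots,\Lambda_{p-1}\ge 0$. Let $$f(z)=\prod_{k=0}^{p-1}\big(a_k(z)\big)^{\bar z^k}$$ be a log-$p$-analytic function satisfying $f(0)=\lambda_f(0)=1$. Suppose that for each $k\in\{0,1,\dots,p-1\}$ we have that (i) $a_k(z)$ is log-analytic in $U$, $a_k(0)=a_k'(0)=1$, and $A_k(z):=\log a_k(z)$; (ii) for each $k\in\{1,\dots,p-1\}$, $|A_k'(z)|\le\Lambda_k$, and $|A_0'(z)|<\Lambda_0$, for all $z\in U$. Then $f$ is univalent in $U_{\rho_1}$, where $\rho_1$ is the unique root in $(0,1)$ of the equation $$\Lambda_0\frac{1-\Lambda_0 r}{\Lambda_0-r}-\sum_{k=1}^{p-1}(k+1)\Lambda_k r^k=0.$$ Moreover, the range $f(U_{\rho_1})$ contains a schlicht disk $U(w_1,r_1)$, where $$\sigma_1=\Lambda_0^2\rho_1-\sum_{k=1}^{p-1}\Lambda_k\rho_1^{k+1}+(\Lambda_0^3-\Lambda_0)\ln\Big(1-\frac{\rho_1}{\Lambda_0}\Big)$$ and $$w_1=\cosh\sigma_1,\qquad r_1=\sinh\sigma_1.$$ This result is sharp.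
   Context: For $r>0$, $U_r=\{z\in\mathbb C:|z|<r\}$, $U=U_1$, and $U(w,r)=\{\zeta\in\mathbb C:|\zeta-w|<r\}$. A continuous complex-valued function $F$ on a domain $D\subset\mathbb C$ is poly-analytic of order $p$ if $\partial^pF/\partial\bar z^p=0$ in $D$. A function $f$ is log-$p$-analytic in $D$ if $\log f$ is poly-analytic of order $p$ in $D$; log-analytic means log-$1$-analytic. Here $\log$ is taken to be its principal branch such that $\log 1=0$. The power is $(a_k(z))^{\bar z^k}=\exp(\bar z^k\log a_k(z))$. For a continuously differentiable $f$, $\lambda_f(z)=\big||f_z(z)|-|f_{\bar z}(z)|\big|$. Univalent means injective. A schlicht disk in the range of $f$ is a disk that is the univalent image under $f$ of some region. Empty sums are $0$.
   Formalization: Sharpness is proved in the wider class requiring a_k'(0)=1 only for k=0 (where the conclusion is proved too): as stated it fails for p≥2, e.g. no f exists if some Λ_k<1, k≥1. The log is the continuous branch along the function with log 1=0. *)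

theory Defs
  imports "HOL-Complex_Analysis.Complex_Analysis"
begin

text \<open>Wirtinger derivatives, from the real Frechet derivative on the plane.\<close>

definition wirt_z :: "(complex \<Rightarrow> complex) \<Rightarrow> complex \<Rightarrow> complex" where
  "wirt_z F z =
     (frechet_derivative F (at z) 1 - \<i> * frechet_derivative F (at z) \<i>) / 2"

definition wirt_zbar :: "(complex \<Rightarrow> complex) \<Rightarrow> complex \<Rightarrow> complex" where
  "wirt_zbar F z =
     (frechet_derivative F (at z) 1 + \<i> * frechet_derivative F (at z) \<i>) / 2"

definition lambda_min :: "(complex \<Rightarrow> complex) \<Rightarrow> complex \<Rightarrow> real" where
  "lambda_min f z = \<bar>cmod (wirt_z f z) - cmod (wirt_zbar f z)\<bar>"

text \<open>Real differentiability of the lower iterates is what makes the \<open>p\<close>-th iterate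
  meaningful. The set \<open>D\<close> is meant to be a domain (open and connected).\<close>

definition poly_analytic_on :: "nat \<Rightarrow> (complex \<Rightarrow> complex) \<Rightarrow> complex set \<Rightarrow> bool" where
  "poly_analytic_on p F D \<longleftrightarrow>
     continuous_on D F \<and>
     (\<forall>k<p. \<forall>z\<in>D. (wirt_zbar ^^ k) F differentiable (at z)) \<and>
     (\<forall>z\<in>D. (wirt_zbar ^^ p) F z = 0)"

text \<open>\<open>L\<close> is a logarithm of the function \<open>f\<close> on \<open>D\<close>: a continuous branch along \<open>f\<close>. It need
  not be \<open>Ln \<circ> f\<close>, which is discontinuous as soon as \<open>f\<close> crosses the negative real axis.\<close>

definition log_branch_on :: "complex set \<Rightarrow> (complex \<Rightarrow> complex) \<Rightarrow> (complex \<Rightarrow> complex) \<Rightarrow> bool"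
  where "log_branch_on D f L \<longleftrightarrow> continuous_on D L \<and> (\<forall>z\<in>D. exp (L z) = f z)"

text \<open>Two branches on a domain differ by a constant, so the choice of the branch is
  immaterial here.\<close>

definition log_p_analytic_on :: "nat \<Rightarrow> (complex \<Rightarrow> complex) \<Rightarrow> complex set \<Rightarrow> bool" where
  "log_p_analytic_on p f D \<longleftrightarrow> (\<exists>L. log_branch_on D f L \<and> poly_analytic_on p L D)"

text \<open>The hypotheses on \<open>f\<close> and \<open>a\<^sub>k\<close>, \<open>A\<^sub>k\<close> in the unit disk. The condition
  \<open>A\<^sub>k(0) = Ln (a\<^sub>k(0))\<close> (that is, \<open>A\<^sub>k(0) = 0\<close>) singles out the branch with \<open>log 1 = 0\<close>.
  \<open>N\<close> is the set of indices \<open>k\<close> for which \<open>a\<^sub>k'(0) = 1\<close> is imposed.\<close>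

definition landau_class ::
    "nat set \<Rightarrow> nat \<Rightarrow> (nat \<Rightarrow> real) \<Rightarrow> (nat \<Rightarrow> complex \<Rightarrow> complex) \<Rightarrow>
     (nat \<Rightarrow> complex \<Rightarrow> complex) \<Rightarrow> (complex \<Rightarrow> complex) \<Rightarrow> bool" where
  "landau_class N p \<Lambda> a A f \<longleftrightarrow>
     log_p_analytic_on p f (ball 0 1) \<and>
     (\<forall>z\<in>ball 0 1. f z = (\<Prod>k<p. exp (cnj z ^ k * A k z))) \<and>
     f 0 = 1 \<and> lambda_min f 0 = 1 \<and>
     (\<forall>k<p. log_p_analytic_on 1 (a k) (ball 0 1) \<and> a k 0 = 1 \<and>
            log_branch_on (ball 0 1) (a k) (A k) \<and> A k 0 = Ln (a k 0)) \<and>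
     (\<forall>k\<in>N. deriv (a k) 0 = 1) \<and>
     (\<forall>z\<in>ball 0 1. cmod (deriv (A 0) z) < \<Lambda> 0) \<and>
     (\<forall>k\<in>{1..<p}. \<forall>z\<in>ball 0 1. cmod (deriv (A k) z) \<le> \<Lambda> k)"

definition schlicht_disk_in ::
    "(complex \<Rightarrow> complex) \<Rightarrow> complex set \<Rightarrow> complex \<Rightarrow> real \<Rightarrow> bool" where
  "schlicht_disk_in f D w r \<longleftrightarrow>
     0 < r \<and> (\<exists>G\<subseteq>D. open G \<and> connected G \<and> inj_on f G \<and> f ` G = ball w r)"

definition landau_lhs :: "nat \<Rightarrow> (nat \<Rightarrow> real) \<Rightarrow> real \<Rightarrow> real" where
  "landau_lhs p \<Lambda> r =
     \<Lambda> 0 * ((1 - \<Lambda> 0 * r) / (\<Lambda> 0 - r)) - (\<Sum>k\<in>{1..<p}. (real k + 1) * \<Lambda> k * r ^ k)"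

definition landau_sigma :: "nat \<Rightarrow> (nat \<Rightarrow> real) \<Rightarrow> real \<Rightarrow> real" where
  "landau_sigma p \<Lambda> \<rho> =
     (\<Lambda> 0)\<^sup>2 * \<rho> - (\<Sum>k\<in>{1..<p}. \<Lambda> k * \<rho> ^ (k + 1))
       + ((\<Lambda> 0) ^ 3 - \<Lambda> 0) * ln (1 - \<rho> / \<Lambda> 0)"

text \<open>The conclusion for one function \<open>f\<close>.\<close>

definition landau_conclusion ::
    "nat \<Rightarrow> (nat \<Rightarrow> real) \<Rightarrow> real \<Rightarrow> (complex \<Rightarrow> complex) \<Rightarrow> bool" where
  "landau_conclusion p \<Lambda> \<rho> f \<longleftrightarrow>
     inj_on f (ball 0 \<rho>) \<and>
     schlicht_disk_in f (ball 0 \<rho>)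
       (of_real (cosh (landau_sigma p \<Lambda> \<rho>))) (sinh (landau_sigma p \<Lambda> \<rho>))"

text \<open>Sharpness, for given \<open>p\<close> and \<open>\<Lambda>\<close>: the conclusion is valid throughout the class, and a
  single member of it admits no larger radius of univalence and no larger radius of a schlicht
  disk about the same centre. The class is taken with \<open>N = {0}\<close>. With \<open>N = {..<p}\<close> no extremal
  function exists in general: \<open>a\<^sub>k'(0) = 1\<close> means \<open>A\<^sub>k'(0) = 1\<close>, so the class is empty
  if some \<open>\<Lambda>\<^sub>k < 1\<close> with \<open>1 \<le> k < p\<close>, whereas the extremal function has
  \<open>A\<^sub>k(z) = - \<Lambda>\<^sub>k z\<close> for \<open>k \<ge> 1\<close>. For \<open>p = 1\<close> the two classes coincide.\<close>

definition landau_sharp :: "nat \<Rightarrow> (nat \<Rightarrow> real) \<Rightarrow> real \<Rightarrow> bool" where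
  "landau_sharp p \<Lambda> \<rho> \<longleftrightarrow>
     (\<forall>a A f. landau_class {0} p \<Lambda> a A f \<longrightarrow> landau_conclusion p \<Lambda> \<rho> f) \<and>
     (\<exists>a A f. landau_class {0} p \<Lambda> a A f \<and>
        (\<forall>r>\<rho>. \<not> inj_on f (ball 0 r)) \<and>
        (\<forall>r > sinh (landau_sigma p \<Lambda> \<rho>).
           \<not> schlicht_disk_in f (ball 0 \<rho>) (of_real (cosh (landau_sigma p \<Lambda> \<rho>))) r))"

end

theory Submission
  imports Defs
begin

text \<open>A logarithm of \<open>f\<close> is \<open>F(z) = A\<^sub>0(z) + H(z)\<close>, where \<open>H\<close> collects the terms
  \<open>cnj z ^ k * A\<^sub>k(z)\<close> with \<open>k \<ge> 1\<close>. By the Schwarz--Pick lemma \<open>A\<^sub>0'\<close> maps \<open>cball 0 r\<close> into a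
  pseudohyperbolic disk whose leftmost point is \<open>\<Lambda>\<^sub>0 (1 - \<Lambda>\<^sub>0 r) / (\<Lambda>\<^sub>0 - r)\<close>, while \<open>H\<close> is
  Lipschitz on \<open>cball 0 r\<close> with constant \<open>\<Sum>k. (k + 1) \<Lambda>\<^sub>k r\<^sup>k\<close>. The difference of the two is
  \<open>landau_lhs\<close>, whence \<open>F\<close> is injective below its root \<open>\<rho>\<close>; integrating along rays gives
  \<open>landau_sigma |z| \<le> |F z|\<close>. As \<open>|F| < 3 < \<pi>\<close> on \<open>ball 0 \<rho>\<close>, the exponential is injective on the
  image of \<open>F\<close>. By invariance of domain this image contains the disk of radius
  \<open>\<sigma> = landau_sigma \<rho>\<close> about \<open>0\<close>, whose image under \<open>exp\<close> contains the disk with diameter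
  \<open>[e\<^sup>-\<^sup>\<sigma>, e\<^sup>\<sigma>]\<close>.

  For the sharpness let \<open>A\<^sub>0'\<close> be \<open>\<Lambda>\<^sub>0 (1 - \<Lambda>\<^sub>0 z) / (\<Lambda>\<^sub>0 - z)\<close> and \<open>A\<^sub>k(z) = - \<Lambda>\<^sub>k z\<close>. Then
  \<open>F = landau_sigma\<close> on the positive radius, which increases up to \<open>\<rho>\<close> and decreases beyond.\<close>

section \<open>The exponential image of a disk\<close>

text \<open>The logarithmic derivative \<open>y - tan y\<close> is nonpositive for
  \<open>0 <= y < pi / 2\<close>, which is \<open>y * cos y <= sin y\<close>; evenness covers
  negative \<open>y\<close>.\<close>

lemma exp_half_square_mult_cos_le_1:
  fixes y :: real
  assumes "\<bar>y\<bar> < pi / 2"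
  shows "exp (y\<^sup>2 / 2) * cos y \<le> 1"
proof -
  have *: "exp (y\<^sup>2 / 2) * cos y \<le> 1" if y: "0 \<le> y" "y < pi / 2" for y :: real
  proof -
    have sin_ge: "x * cos x \<le> sin x" if "0 \<le> x" "x < pi / 2" for x :: real
    proof -
      have "(\<lambda>x. sin x - x * cos x) 0 \<le> (\<lambda>x. sin x - x * cos x) x"
      proof (rule DERIV_nonneg_imp_nondecreasing[OF that(1)])
        fix u :: real assume u: "0 \<le> u" "u \<le> x"
        have "((\<lambda>x. sin x - x * cos x) has_real_derivative u * sin u) (at u)"
          by (rule derivative_eq_intros refl | simp)+
        moreover have "0 \<le> u * sin u"
          using u that by (intro mult_nonneg_nonneg sin_ge_zero) auto
        ultimately show "\<exists>d. ((\<lambda>x. sin x - x * cos x) has_real_derivative d) (at u) \<and> 0 \<le> d"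
          by blast
      qed
      then show ?thesis by simp
    qed
    have "(\<lambda>y. exp (y\<^sup>2 / 2) * cos y) y \<le> (\<lambda>y. exp (y\<^sup>2 / 2) * cos y) 0"
    proof (rule DERIV_nonpos_imp_nonincreasing[OF y(1)])
      fix x assume x: "0 \<le> x" "x \<le> y"
      have "((\<lambda>y. exp (y\<^sup>2 / 2) * cos y) has_real_derivative exp (x\<^sup>2 / 2) * (x * cos x - sin x)) (at x)"
        by (auto intro!: derivative_eq_intros simp: algebra_simps)
      moreover have "exp (x\<^sup>2 / 2) * (x * cos x - sin x) \<le> 0"
        using sin_ge[of x] x y by (simp add: mult_le_0_iff)
      ultimately show "\<exists>d. ((\<lambda>y. exp (y\<^sup>2 / 2) * cos y) has_real_derivative d) (at x) \<and> d \<le> 0"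
        by blast
    qed
    then show ?thesis by simp
  qed
  show ?thesis
    using *[of "\<bar>y\<bar>"] assms by simp
qed

text \<open>Here the logarithmic derivative is \<open>tanh x - x\<close>, so everything rests on
  \<open>sinh x <= x * cosh x\<close>.\<close>

lemma cosh_mult_exp_half_square_antimono:
  fixes s t :: real
  assumes "0 \<le> s" "s \<le> t"
  shows "cosh t * exp (- (t\<^sup>2 / 2)) \<le> cosh s * exp (- (s\<^sup>2 / 2))"
proof (rule DERIV_nonpos_imp_nonincreasing[OF assms(2)])
  fix x assume "s \<le> x" "x \<le> t"
  then have x: "0 \<le> x" using assms by simp
  have "(\<lambda>x. x * cosh x - sinh x) 0 \<le> (\<lambda>x. x * cosh x - sinh x) x"
  proof (rule DERIV_nonneg_imp_nondecreasing[OF x])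
    fix u :: real assume "0 \<le> u" "u \<le> x"
    have "((\<lambda>x. x * cosh x - sinh x) has_real_derivative u * sinh u) (at u)"
      by (rule derivative_eq_intros refl | simp)+
    moreover have "0 \<le> u * sinh u"
      using \<open>0 \<le> u\<close> by simp
    ultimately show "\<exists>d. ((\<lambda>x. x * cosh x - sinh x) has_real_derivative d) (at u) \<and> 0 \<le> d"
      by blast
  qed
  then have "exp (- (x\<^sup>2 / 2)) * (sinh x - x * cosh x) \<le> 0"
    by (simp add: mult_le_0_iff)
  moreover have "((\<lambda>t. cosh t * exp (- (t\<^sup>2 / 2))) has_real_derivative
      exp (- (x\<^sup>2 / 2)) * (sinh x - x * cosh x)) (at x)"
    by (auto intro!: derivative_eq_intros simp: algebra_simps)
  ultimately show "\<exists>d. ((\<lambda>t. cosh t * exp (- (t\<^sup>2 / 2))) has_real_derivative d) (at x) \<and> d \<le> 0"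
    by blast
qed

text \<open>With \<open>Ln w = x + \<i> y\<close>, membership in the ball means \<open>cosh x < cosh s * cos y\<close>; on the other
  hand \<open>ln (cosh t) - t\<^sup>2 / 2\<close> decreases in \<open>t\<close> and \<open>ln (cos y) \<le> - y\<^sup>2 / 2\<close>.\<close>

lemma ball_cosh_sinh_subset:
  fixes s :: real and w :: complex
  assumes s: "0 < s" and w: "w \<in> ball (of_real (cosh s)) (sinh s)"
  shows "0 < Re w" and "cmod (Ln w) < s"
proof -
  have "(cmod (of_real (cosh s) - w))\<^sup>2 < (sinh s)\<^sup>2"
    using w by (intro power_strict_mono) (auto simp: dist_norm)
  then have q: "(Re w)\<^sup>2 + (Im w)\<^sup>2 + 1 < 2 * cosh s * Re w"
    using cosh_square_eq[of s] by (simp add: cmod_power2 power2_diff algebra_simps)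
  then have "0 < 2 * cosh s * Re w"
    by (smt (verit) zero_le_power2)
  then show Re: "0 < Re w"
    using cosh_real_pos[of s] by (simp add: zero_less_mult_iff)
  then have w0: "w \<noteq> 0" by auto
  define x y where "x = Re (Ln w)" and "y = Im (Ln w)"
  have y: "\<bar>y\<bar> < pi / 2"
    using Re Re_Ln_pos_lt[OF w0] by (simp add: y_def)
  have "w = exp (Ln w)" using w0 by simp
  then have Rw: "Re w = exp x * cos y" "Im w = exp x * sin y"
    by (metis Re_exp x_def y_def, metis Im_exp x_def y_def)
  have "(Re w)\<^sup>2 + (Im w)\<^sup>2 = (exp x)\<^sup>2 * ((cos y)\<^sup>2 + (sin y)\<^sup>2)"
    by (simp only: Rw power_mult_distrib distrib_left)
  then have "(exp x)\<^sup>2 + 1 < 2 * cosh s * (exp x * cos y)"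
    using q Rw by simp
  moreover have "(exp x)\<^sup>2 + 1 = exp x * (2 * cosh x)"
    by (simp add: cosh_field_def power2_eq_square field_simps exp_minus)
  ultimately have "exp x * cosh x < exp x * (cosh s * cos y)"
    by (simp add: algebra_simps)
  then have c: "cosh x < cosh s * cos y" by simp
  show "cmod (Ln w) < s"
  proof (rule ccontr)
    define t where "t = cmod (Ln w)"
    assume "\<not> cmod (Ln w) < s"
    then have t: "s \<le> t" by (simp add: t_def)
    have t2: "t\<^sup>2 = x\<^sup>2 + y\<^sup>2" by (simp add: t_def x_def y_def cmod_power2)
    have "cos y > 0" using y by (intro cos_gt_zero_pi) auto
    have "\<bar>x\<bar> \<le> t" by (simp add: t_def x_def abs_Re_le_cmod)
    have "cosh s * cos y \<le> cosh t * cos y"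
      using t s \<open>cos y > 0\<close> by (simp add: cosh_real_nonneg_le_iff)
    also have "\<dots> = (cosh t * exp (- (t\<^sup>2 / 2))) * (exp (t\<^sup>2 / 2) * cos y)"
      by (simp add: exp_minus)
    \<comment> \<open>Only the antitone factor passes from \<open>t\<close> to \<open>|x|\<close>.
      As \<open>t^2 = x^2 + y^2\<close>, the exponentials then combine to
      \<open>exp (y^2 / 2)\<close>, which \<open>cos y\<close> compensates.\<close>
    also have "\<dots> \<le> (cosh \<bar>x\<bar> * exp (- (\<bar>x\<bar>\<^sup>2 / 2))) * (exp (t\<^sup>2 / 2) * cos y)"
      using cosh_mult_exp_half_square_antimono[OF _ \<open>\<bar>x\<bar> \<le> t\<close>] \<open>cos y > 0\<close>
      by (intro mult_right_mono) auto
    also have "\<dots> = cosh x * (exp (y\<^sup>2 / 2) * cos y)"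
      by (simp add: t2 add_divide_distrib exp_add exp_minus)
    also have "\<dots> \<le> cosh x"
      using exp_half_square_mult_cos_le_1[OF y] by (simp add: mult_left_le)
    finally show False using c by simp
  qed
qed

section \<open>The Schwarz--Pick lemma\<close>

text \<open>The Moebius map \<open>w -> L (w - 1) / (L^2 - w)\<close> takes the disk of radius
  \<open>L\<close> to the unit disk and \<open>1\<close> to \<open>0\<close>. Composing it with
  \<open>g\<close> gives \<open>h\<close>, to which the Schwarz lemma applies.\<close>

lemma Schwarz_Pick_at_1:
  fixes g :: "complex \<Rightarrow> complex" and L :: real
  assumes hol: "g holomorphic_on ball 0 1" and g0: "g 0 = 1" and L: "1 < L"
    and bd: "\<And>z. z \<in> ball 0 1 \<Longrightarrow> cmod (g z) < L" and z: "z \<in> ball 0 1"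
  shows "L * cmod (g z - 1) \<le> cmod z * cmod (of_real (L\<^sup>2) - g z)"
proof -
  have L2: "L < L\<^sup>2" using L by (simp add: power2_eq_square)
  have nz: "of_real (L\<^sup>2) - g z \<noteq> 0" if "z \<in> ball 0 1" for z
  proof
    assume "of_real (L\<^sup>2) - g z = 0"
    then have "g z = of_real (L\<^sup>2)" by simp
    then have "cmod (g z) = L\<^sup>2" by (metis abs_power2 norm_of_real)
    then show False using bd[OF that] L2 by simp
  qed
  define h where "h = (\<lambda>z. of_real L * (g z - 1) / (of_real (L\<^sup>2) - g z))"
  have "norm (h z) \<le> norm z"
  proof (rule Schwarz_Lemma(1))
    show "h holomorphic_on ball 0 1"
      unfolding h_def using nz by (intro holomorphic_intros hol) auto
    show "h 0 = 0" by (simp add: h_def g0)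
    show "norm z < 1" using z by simp
  next
    fix z :: complex assume "norm z < 1"
    then have zb: "z \<in> ball 0 1" by simp
    have "(cmod (g z))\<^sup>2 < L\<^sup>2"
      using bd[OF zb] by (intro power_strict_mono) auto
    \<comment> \<open>This product is exactly the difference of the squared moduli of denominator
      and numerator of \<open>h z\<close>.\<close>
    then have "0 < (L\<^sup>2 - 1) * (L\<^sup>2 - (cmod (g z))\<^sup>2)"
      using L L2 by (intro mult_pos_pos) auto
    also have "\<dots> = (cmod (of_real (L\<^sup>2) - g z))\<^sup>2 - (L * cmod (g z - 1))\<^sup>2"
      by (simp add: cmod_power2 power_mult_distrib) (simp add: power2_eq_square algebra_simps)
    finally have "(L * cmod (g z - 1))\<^sup>2 < (cmod (of_real (L\<^sup>2) - g z))\<^sup>2"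
      by (simp only: diff_gt_0_iff_gt)
    then have "L * cmod (g z - 1) < cmod (of_real (L\<^sup>2) - g z)"
      by (rule power2_less_imp_less) (rule norm_ge_zero)
    then show "norm (h z) < 1"
      using nz[OF zb] L by (simp add: h_def norm_divide norm_mult del: of_real_power)
  qed
  then have "L * cmod (g z - 1) / cmod (of_real (L\<^sup>2) - g z) \<le> cmod z"
    using L by (simp add: h_def norm_divide norm_mult del: of_real_power)
  then show ?thesis
    using nz[OF z] by (simp add: pos_divide_le_eq del: of_real_power)
qed

lemma pseudohyperbolic_disk_Re_ge:
  fixes w :: complex and L r :: real
  assumes L: "1 < L" and r: "0 \<le> r" "r < 1"
    and w: "L * cmod (w - 1) \<le> r * cmod (of_real (L\<^sup>2) - w)"
  shows "L * ((1 - L * r) / (L - r)) \<le> Re w"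
proof -
  have "(L * cmod (w - 1))\<^sup>2 \<le> (r * cmod (of_real (L\<^sup>2) - w))\<^sup>2"
    using w L by (intro power_mono) auto
  then have "L\<^sup>2 * (Re w - 1)\<^sup>2 + L\<^sup>2 * (Im w)\<^sup>2 \<le> r\<^sup>2 * (L\<^sup>2 - Re w)\<^sup>2 + r\<^sup>2 * (Im w)\<^sup>2"
    by (simp add: power_mult_distrib cmod_power2 algebra_simps)
  moreover have "r\<^sup>2 * (Im w)\<^sup>2 \<le> L\<^sup>2 * (Im w)\<^sup>2"
    using L r by (intro mult_right_mono power_mono) auto
  ultimately have "(L * (Re w - 1))\<^sup>2 \<le> (r * (L\<^sup>2 - Re w))\<^sup>2"
    by (simp add: power_mult_distrib)
  then have a: "L * \<bar>Re w - 1\<bar> \<le> r * \<bar>L\<^sup>2 - Re w\<bar>"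
    using L r by (simp add: abs_le_square_iff[symmetric] abs_mult)
  have "1 < L\<^sup>2" using L by simp
  have "L * (1 - L * r) \<le> Re w * (L - r)"
  proof (cases "Re w \<ge> 1")
    case True
    have "L * (1 - L * r) \<le> L - r"
      using L r mult_mono[of 1 L 1 L] mult_left_mono[of 1 "L * L" r] by (simp add: algebra_simps)
    also have "\<dots> \<le> Re w * (L - r)"
      using True L r by simp
    finally show ?thesis .
  next
    case False
    then have "L * (1 - Re w) \<le> r * (L\<^sup>2 - Re w)"
      using a \<open>1 < L\<^sup>2\<close> by simp
    then show ?thesis by (simp add: algebra_simps power2_eq_square)
  qed
  then show ?thesis using L r by (simp add: divide_simps)
qed

text \<open>Writing \<open>L^2 - w\<close> as \<open>(L^2 - 1) - (w - 1)\<close>, the triangle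
  inequality leaves \<open>(L^2 - 1) |w - 1| <= L^2 - 1\<close>. This is what later bounds
  \<open>A 0\<close> below the root.\<close>

lemma pseudohyperbolic_disk_near_1:
  fixes w :: complex and L r :: real
  assumes L: "1 < L" and r: "r \<le> 1 / L"
    and w: "L * cmod (w - 1) \<le> r * cmod (of_real (L\<^sup>2) - w)"
  shows "cmod (w - 1) \<le> 1"
proof -
  have L2: "1 < L\<^sup>2" using L by simp
  have "r * cmod (of_real (L\<^sup>2) - w) \<le> (1 / L) * cmod (of_real (L\<^sup>2) - w)"
    using r by (intro mult_right_mono) auto
  then have "L * (L * cmod (w - 1)) \<le> L * ((1 / L) * cmod (of_real (L\<^sup>2) - w))"
    using w L by (intro mult_left_mono) auto
  then have "L\<^sup>2 * cmod (w - 1) \<le> cmod (of_real (L\<^sup>2) - w)"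
    using L by (simp add: power2_eq_square mult.assoc)
  also have "\<dots> = cmod (of_real (L\<^sup>2 - 1) - (w - 1))" by simp
  also have "\<dots> \<le> (L\<^sup>2 - 1) + cmod (w - 1)"
    using norm_triangle_ineq4[of "of_real (L\<^sup>2 - 1) :: complex" "w - 1"] L2
    by (smt (verit) norm_of_real)
  finally have "(L\<^sup>2 - 1) * cmod (w - 1) \<le> (L\<^sup>2 - 1) * 1"
    by (simp add: algebra_simps)
  then show ?thesis using L2 by (simp only: mult_le_cancel_left_pos)
qed

section \<open>Covering by invariance of domain\<close>

text \<open>The points of \<open>ball 0 s\<close> covered by the open ball are also those covered by the
  closed ball, since the sphere is mapped outside \<open>ball 0 s\<close>. They thus form a clopen subset.\<close>

lemma inj_on_ball_image_supset:
  fixes F :: "'a::euclidean_space \<Rightarrow> 'a"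
  assumes cont: "continuous_on (cball 0 \<rho>) F" and inj: "inj_on F (ball 0 \<rho>)"
    and F0: "F 0 = 0" and \<rho>: "0 < \<rho>" and sph: "\<And>z. norm z = \<rho> \<Longrightarrow> s \<le> norm (F z)"
  shows "ball 0 s \<subseteq> F ` ball 0 \<rho>"
proof (cases "0 < s")
  case True
  define C where "C = ball 0 s \<inter> F ` ball 0 \<rho>"
  have "open (F ` ball 0 \<rho>)"
    using cont inj by (intro invariance_of_domain)
       (auto intro: continuous_on_subset[OF _ ball_subset_cball])
  then have op: "openin (top_of_set (ball 0 s)) C"
    unfolding C_def by blast
  have "C = ball 0 s \<inter> F ` cball 0 \<rho>"
    unfolding C_def using sph by (force simp: le_less)
  moreover have "closed (F ` cball 0 \<rho>)"
    using cont by (intro compact_imp_closed compact_continuous_image) auto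
  ultimately have cl: "closedin (top_of_set (ball 0 s)) C"
    by (auto simp: closedin_closed)
  have "0 \<in> C" using F0 \<rho> True by (auto simp: C_def image_iff intro!: bexI[of _ 0])
  then have "C = ball 0 s"
    using op cl connected_clopen[of "ball (0::'a) s"] by auto
  then show ?thesis by (auto simp: C_def)
qed (simp add: ball_empty)

section \<open>The defining equation of the radius\<close>

locale landau_bounds =
  fixes p :: nat and \<Lambda> :: "nat \<Rightarrow> real"
  assumes \<Lambda>0: "1 < \<Lambda> 0" and \<Lambda>_nonneg: "\<forall>k\<in>{1..<p}. 0 \<le> \<Lambda> k"
begin

lemma landau_lhs_0: "landau_lhs p \<Lambda> 0 = 1"
  using \<Lambda>0 by (simp add: landau_lhs_def)

lemma continuous_on_landau_lhs: "continuous_on {0..1} (landau_lhs p \<Lambda>)"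
  unfolding landau_lhs_def using \<Lambda>0 by (intro continuous_intros) auto

lemma landau_main_term_strict_antimono:
  assumes "0 \<le> r" "r < s" "s \<le> 1"
  shows "\<Lambda> 0 * ((1 - \<Lambda> 0 * s) / (\<Lambda> 0 - s)) < \<Lambda> 0 * ((1 - \<Lambda> 0 * r) / (\<Lambda> 0 - r))"
proof -
  have "1 < \<Lambda> 0 * \<Lambda> 0"
    using \<Lambda>0 by (simp add: less_1_mult)
  \<comment> \<open>This is the difference of the two sides after clearing denominators.\<close>
  then have "0 < (\<Lambda> 0 * \<Lambda> 0 - 1) * (s - r)"
    using assms by simp
  then have "(1 - \<Lambda> 0 * s) / (\<Lambda> 0 - s) < (1 - \<Lambda> 0 * r) / (\<Lambda> 0 - r)"
    using assms \<Lambda>0 by (simp add: divide_less_eq pos_less_divide_eq) (simp add: field_simps)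
  then show ?thesis using \<Lambda>0 by (intro mult_strict_left_mono) auto
qed

lemma landau_lhs_strict_antimono:
  assumes "0 \<le> r" "r < s" "s \<le> 1"
  shows "landau_lhs p \<Lambda> s < landau_lhs p \<Lambda> r"
proof -
  have "(\<Sum>k\<in>{1..<p}. (real k + 1) * \<Lambda> k * r ^ k) \<le> (\<Sum>k\<in>{1..<p}. (real k + 1) * \<Lambda> k * s ^ k)"
    using assms \<Lambda>_nonneg by (intro sum_mono mult_left_mono power_mono) auto
  then show ?thesis
    using landau_main_term_strict_antimono[OF assms] by (simp add: landau_lhs_def)
qed

text \<open>At \<open>1 / \<Lambda> 0\<close> the main term vanishes and only the subtracted sum is
  left, while the value at \<open>0\<close> is \<open>1\<close>. The bound by
  \<open>1 / \<Lambda> 0\<close>, stronger than \<open>\<rho> < 1\<close>, is what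
  \<open>F_less_3\<close> requires.\<close>

lemma landau_lhs_root:
  obtains \<rho> where "0 < \<rho>" "\<rho> \<le> 1 / \<Lambda> 0" "landau_lhs p \<Lambda> \<rho> = 0"
proof -
  have "landau_lhs p \<Lambda> (1 / \<Lambda> 0) = - (\<Sum>k\<in>{1..<p}. (real k + 1) * \<Lambda> k * (1 / \<Lambda> 0) ^ k)"
    using \<Lambda>0 by (simp add: landau_lhs_def)
  also have "\<dots> \<le> 0"
    using \<Lambda>0 \<Lambda>_nonneg by (auto intro!: sum_nonneg)
  finally have "landau_lhs p \<Lambda> (1 / \<Lambda> 0) \<le> 0" .
  moreover have "continuous_on {0..1 / \<Lambda> 0} (landau_lhs p \<Lambda>)"
    using \<Lambda>0 by (intro continuous_on_subset[OF continuous_on_landau_lhs]) auto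
  ultimately obtain \<rho> where "0 \<le> \<rho>" "\<rho> \<le> 1 / \<Lambda> 0" "landau_lhs p \<Lambda> \<rho> = 0"
    using IVT2'[of "landau_lhs p \<Lambda>" "1 / \<Lambda> 0" 0 0] \<Lambda>0 landau_lhs_0 by auto
  moreover have "\<rho> \<noteq> 0" using \<open>landau_lhs p \<Lambda> \<rho> = 0\<close> landau_lhs_0 by auto
  ultimately show ?thesis using that[of \<rho>] by simp
qed

text \<open>By partial fractions the main term is \<open>L^2 - (L^3 - L) / (L - r)\<close> with
  \<open>L = \<Lambda> 0\<close>, which explains the logarithm in
  \<open>landau_sigma\<close>.\<close>

lemma DERIV_landau_main_term_primitive:
  assumes "r \<le> 1"
  shows "((\<lambda>r. (\<Lambda> 0)\<^sup>2 * r + ((\<Lambda> 0) ^ 3 - \<Lambda> 0) * ln (1 - r / \<Lambda> 0)) has_real_derivative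
    \<Lambda> 0 * ((1 - \<Lambda> 0 * r) / (\<Lambda> 0 - r))) (at r)"
proof -
  have r: "r < \<Lambda> 0" using assms \<Lambda>0 by simp
  have "((\<lambda>r. (\<Lambda> 0)\<^sup>2 * r + ((\<Lambda> 0) ^ 3 - \<Lambda> 0) * ln (1 - r / \<Lambda> 0)) has_real_derivative
    (\<Lambda> 0)\<^sup>2 + ((\<Lambda> 0) ^ 3 - \<Lambda> 0) * (- (1 / \<Lambda> 0) / (1 - r / \<Lambda> 0))) (at r)"
    using r \<Lambda>0 by (auto intro!: derivative_eq_intros)
  moreover have "(\<Lambda> 0)\<^sup>2 + ((\<Lambda> 0) ^ 3 - \<Lambda> 0) * (- (1 / \<Lambda> 0) / (1 - r / \<Lambda> 0))
      = \<Lambda> 0 * ((1 - \<Lambda> 0 * r) / (\<Lambda> 0 - r))"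
    using r \<Lambda>0 by (simp add: divide_simps) (simp add: power2_eq_square power3_eq_cube algebra_simps)
  ultimately show ?thesis by metis
qed

text \<open>With \<open>landau_sigma_0\<close> this makes \<open>landau_sigma\<close> the integral
  of \<open>landau_lhs\<close> from \<open>0\<close>, so on the unit interval it peaks at the
  root.\<close>

lemma DERIV_landau_sigma:
  assumes "r \<le> 1"
  shows "(landau_sigma p \<Lambda> has_real_derivative landau_lhs p \<Lambda> r) (at r)"
proof -
  have "((\<lambda>r. \<Sum>k\<in>{1..<p}. \<Lambda> k * r ^ (k + 1)) has_real_derivative
      (\<Sum>k\<in>{1..<p}. (real k + 1) * \<Lambda> k * r ^ k)) (at r)"
  proof (rule DERIV_sum)
    fix k assume "k \<in> {1..<p}"
    show "((\<lambda>r. \<Lambda> k * r ^ (k + 1)) has_real_derivative (real k + 1) * \<Lambda> k * r ^ k) (at r)"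
      by (rule derivative_eq_intros refl | simp)+
  qed
  from DERIV_diff[OF DERIV_landau_main_term_primitive[OF assms] this]
  show ?thesis
    by (simp add: landau_lhs_def landau_sigma_def[abs_def] algebra_simps)
qed

lemma continuous_on_landau_sigma: "s \<le> 1 \<Longrightarrow> continuous_on {r..s} (landau_sigma p \<Lambda>)"
  by (intro continuous_at_imp_continuous_on ballI DERIV_isCont[OF DERIV_landau_sigma]) auto

lemma landau_sigma_0: "landau_sigma p \<Lambda> 0 = 0"
  by (simp add: landau_sigma_def)

lemma landau_sigma_strict_mono:
  assumes "0 \<le> r" "r < s" "s \<le> \<rho>" "\<rho> \<le> 1" "landau_lhs p \<Lambda> \<rho> = 0"
  shows "landau_sigma p \<Lambda> r < landau_sigma p \<Lambda> s"
proof (rule DERIV_pos_imp_increasing_open[OF assms(2)])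
  fix x assume "r < x" "x < s"
  then show "\<exists>d. (landau_sigma p \<Lambda> has_real_derivative d) (at x) \<and> 0 < d"
    using DERIV_landau_sigma[of x] landau_lhs_strict_antimono[of x \<rho>] assms by force
next
  show "continuous_on {r..s} (landau_sigma p \<Lambda>)"
    using assms by (intro continuous_on_landau_sigma) auto
qed

lemma landau_sigma_strict_antimono:
  assumes "0 \<le> \<rho>" "\<rho> \<le> r" "r < s" "s \<le> 1" "landau_lhs p \<Lambda> \<rho> = 0"
  shows "landau_sigma p \<Lambda> s < landau_sigma p \<Lambda> r"
proof (rule DERIV_neg_imp_decreasing_open[OF assms(3)])
  fix x assume "r < x" "x < s"
  then show "\<exists>d. (landau_sigma p \<Lambda> has_real_derivative d) (at x) \<and> d < 0"
    using DERIV_landau_sigma[of x] landau_lhs_strict_antimono[of \<rho> x] assms by force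
next
  show "continuous_on {r..s} (landau_sigma p \<Lambda>)"
    using assms by (intro continuous_on_landau_sigma) auto
qed

text \<open>If the value at \<open>r\<close> is nonnegative, the rising branch on
  \<open>[0, \<rho>]\<close> takes it too. Otherwise the falling branch crosses zero, the value at
  \<open>0\<close>.\<close>

lemma landau_sigma_not_inj:
  assumes \<rho>: "0 < \<rho>" "\<rho> < r" "r < 1" "landau_lhs p \<Lambda> \<rho> = 0"
  obtains x y where "0 \<le> x" "x < y" "y \<le> r" "landau_sigma p \<Lambda> x = landau_sigma p \<Lambda> y"
proof -
  have less: "landau_sigma p \<Lambda> r < landau_sigma p \<Lambda> \<rho>" "0 < landau_sigma p \<Lambda> \<rho>"
    using landau_sigma_strict_antimono[of \<rho> \<rho> r] landau_sigma_strict_mono[of 0 \<rho> \<rho>]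
      landau_sigma_0 \<rho> by auto
  show ?thesis
  proof (cases "0 \<le> landau_sigma p \<Lambda> r")
    case True
    then obtain x where "0 \<le> x" "x \<le> \<rho>" "landau_sigma p \<Lambda> x = landau_sigma p \<Lambda> r"
      using IVT'[of "landau_sigma p \<Lambda>" 0 "landau_sigma p \<Lambda> r" \<rho>] less \<rho> continuous_on_landau_sigma landau_sigma_0 by auto
    then show ?thesis using that[of x r] \<rho> by auto
  next
    case False
    then obtain y where "\<rho> \<le> y" "y \<le> r" "landau_sigma p \<Lambda> y = 0"
      using IVT2'[of "landau_sigma p \<Lambda>" r 0 \<rho>] less \<rho> continuous_on_landau_sigma by auto
    then show ?thesis using that[of 0 y] \<rho> landau_sigma_0 by auto
  qed
qed

end

section \<open>Estimates for the logarithm\<close>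

text \<open>The factor \<open>cnj d\<close> projects onto the direction of motion: it turns the
  derivative \<open>f' * d\<close> into \<open>|d|^2 * f'\<close>.\<close>

lemma DERIV_Re_along_line:
  assumes "(f has_field_derivative f') (at (x + of_real t * d))"
  shows "((\<lambda>t. Re (f (x + of_real t * d) * cnj d)) has_real_derivative (cmod d)\<^sup>2 * Re f') (at t)"
proof -
  have "((\<lambda>w. f (x + w * d) * cnj d) has_field_derivative f' * d * cnj d) (at (of_real t))"
    by (rule DERIV_cmult_right, rule DERIV_chain2[where f = f and g = "\<lambda>w. x + w * d"])
       (auto intro!: derivative_eq_intros assms)
  then have "((\<lambda>t. f (x + of_real t * d) * cnj d) has_vector_derivative f' * d * cnj d) (at t)"
    by (rule has_vector_derivative_real_field)
  then have "((\<lambda>t. Re (f (x + of_real t * d) * cnj d)) has_real_derivative Re (f' * d * cnj d)) (at t)"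
    by (rule has_field_derivative_Re)
  moreover have "Re (f' * d * cnj d) = (cmod d)\<^sup>2 * Re f'"
    by (simp add: cmod_power2) (simp add: power2_eq_square algebra_simps)
  ultimately show ?thesis by simp
qed

text \<open>A quantitative form of the Noshiro--Warschawski argument: the bound on the real part of
  the derivative is integrated along the segment from \<open>x\<close> to \<open>y\<close>.\<close>

lemma Re_diff_ge_of_Re_deriv_ge:
  assumes S: "convex S" and x: "x \<in> S" and y: "y \<in> S"
    and df: "\<And>z. z \<in> S \<Longrightarrow> (f has_field_derivative f' z) (at z)"
    and ge: "\<And>z. z \<in> S \<Longrightarrow> c \<le> Re (f' z)"
  shows "c * (cmod (y - x))\<^sup>2 \<le> Re ((f y - f x) * cnj (y - x))"
proof -
  define d where "d = y - x"
  define \<phi> where "\<phi> = (\<lambda>t. Re (f (x + of_real t * d) * cnj d) - t * (c * (cmod d)\<^sup>2))"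
  have "\<phi> 0 \<le> \<phi> 1"
  proof (rule DERIV_nonneg_imp_nondecreasing[where f = \<phi>])
    fix t :: real assume t: "0 \<le> t" "t \<le> 1"
    have "(1 - t) *\<^sub>R x + t *\<^sub>R y \<in> S"
      using convexD_alt[OF S x y] t by simp
    then have S: "x + of_real t * d \<in> S"
      by (simp add: d_def scaleR_conv_of_real algebra_simps)
    have "(\<phi> has_real_derivative (cmod d)\<^sup>2 * Re (f' (x + of_real t * d)) - 1 * (c * (cmod d)\<^sup>2)) (at t)"
      unfolding \<phi>_def
      by (intro DERIV_diff DERIV_Re_along_line df S DERIV_cmult_right DERIV_ident)
    moreover have "0 \<le> (cmod d)\<^sup>2 * Re (f' (x + of_real t * d)) - 1 * (c * (cmod d)\<^sup>2)"
      using mult_left_mono[OF ge[OF S], of "(cmod d)\<^sup>2"] by (simp add: mult.commute)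
    ultimately show "\<exists>y. (\<phi> has_real_derivative y) (at t) \<and> 0 \<le> y" by blast
  qed simp
  then show ?thesis by (simp add: \<phi>_def d_def algebra_simps)
qed

text \<open>Inserting \<open>cnj x ^ k * a y\<close>, the change of the power contributes
  \<open>k * C * r ^ k\<close>, because \<open>|a y| <= C * r\<close>, and the change of
  \<open>a\<close> contributes \<open>C * r ^ k\<close>.\<close>

lemma cnj_power_mult_diff_le:
  fixes a :: "complex \<Rightarrow> complex" and r C :: real
  assumes k: "1 \<le> k" and x: "cmod x \<le> r" and y: "cmod y \<le> r" and C: "0 \<le> C"
    and a: "cmod (a y) \<le> C * cmod y" "cmod (a y - a x) \<le> C * cmod (y - x)"
  shows "cmod (cnj y ^ k * a y - cnj x ^ k * a x) \<le> (real k + 1) * C * r ^ k * cmod (y - x)"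
proof -
  have r: "0 \<le> r" using x norm_ge_zero order_trans by blast
  have "cmod (y ^ k - x ^ k) \<le> (real k * r ^ (k - 1)) * cmod (y - x)"
  proof (rule field_differentiable_bound[of "cball 0 r" "\<lambda>z. z ^ k" "\<lambda>z. of_nat k * z ^ (k - 1)"])
    fix z :: complex assume "z \<in> cball 0 r"
    then show "cmod (of_nat k * z ^ (k - 1)) \<le> real k * r ^ (k - 1)"
      by (simp add: norm_mult norm_power mult_left_mono power_mono)
    show "((\<lambda>z. z ^ k) has_field_derivative of_nat k * z ^ (k - 1)) (at z within cball 0 r)"
      by (auto intro!: derivative_eq_intros)
  qed (use x y in auto)
  moreover have "cmod (cnj y ^ k - cnj x ^ k) = cmod (y ^ k - x ^ k)"
    by (metis complex_cnj_diff complex_cnj_power complex_mod_cnj)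
  moreover have "cmod (a y) \<le> C * r"
    using a(1) y C by (meson mult_left_mono order_trans)
  ultimately have "cmod ((cnj y ^ k - cnj x ^ k) * a y)
      \<le> ((real k * r ^ (k - 1)) * cmod (y - x)) * (C * r)"
    using r C unfolding norm_mult by (intro mult_mono) auto
  also have "\<dots> = real k * C * r ^ k * cmod (y - x)"
    using k by (cases k) auto
  finally have "cmod ((cnj y ^ k - cnj x ^ k) * a y) \<le> real k * C * r ^ k * cmod (y - x)" .
  moreover have "cmod (cnj x ^ k * (a y - a x)) \<le> r ^ k * (C * cmod (y - x))"
    unfolding norm_mult norm_power using x r C a(2) by (intro mult_mono power_mono) auto
  moreover have "cnj y ^ k * a y - cnj x ^ k * a x
      = (cnj y ^ k - cnj x ^ k) * a y + cnj x ^ k * (a y - a x)"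
    by (simp add: algebra_simps)
  ultimately show ?thesis
    using norm_triangle_ineq[of "(cnj y ^ k - cnj x ^ k) * a y" "cnj x ^ k * (a y - a x)"]
    by (simp add: algebra_simps)
qed

text \<open>Length and coefficients are parameters because the conjugate derivative of such a sum is
  again one, with one term fewer.\<close>

definition log_series :: "nat \<Rightarrow> (nat \<Rightarrow> complex \<Rightarrow> complex) \<Rightarrow> complex \<Rightarrow> complex" where
  "log_series p A z = (\<Sum>k<p. cnj z ^ k * A k z)"

text \<open>The hypotheses in terms of the logarithms alone, as they follow from membership in
  \<open>landau_class {0}\<close>.\<close>

locale landau_logs = landau_bounds +
  fixes A :: "nat \<Rightarrow> complex \<Rightarrow> complex"
  assumes p: "1 \<le> p"
    and hol: "\<And>k. k < p \<Longrightarrow> A k holomorphic_on ball 0 1"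
    and A_0: "\<And>k. k < p \<Longrightarrow> A k 0 = 0"
    and deriv_A0_0: "deriv (A 0) 0 = 1"
    and deriv_A0_less: "\<And>z. z \<in> ball 0 1 \<Longrightarrow> cmod (deriv (A 0) z) < \<Lambda> 0"
    and deriv_A_le: "\<And>k z. k \<in> {1..<p} \<Longrightarrow> z \<in> ball 0 1 \<Longrightarrow> cmod (deriv (A k) z) \<le> \<Lambda> k"
begin

abbreviation F :: "complex \<Rightarrow> complex" where
  "F \<equiv> log_series p A"

definition H :: "complex \<Rightarrow> complex" where
  "H z = (\<Sum>k\<in>{1..<p}. cnj z ^ k * A k z)"

lemma F_eq: "F z = A 0 z + H z"
proof -
  have "{..<p} = insert 0 {1..<p}" using p by auto
  then show ?thesis by (simp add: log_series_def H_def)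
qed

lemma H_0: "H 0 = 0"
  by (auto simp: H_def A_0 intro!: sum.neutral)

lemma F_0: "F 0 = 0"
  using A_0[of 0] p by (simp add: F_eq H_0)

lemma has_deriv_A: "k < p \<Longrightarrow> z \<in> ball 0 1 \<Longrightarrow> (A k has_field_derivative deriv (A k) z) (at z)"
  using holomorphic_derivI[OF hol open_ball] by blast

lemma continuous_on_F: "continuous_on (ball 0 1) F"
  unfolding log_series_def
  by (intro continuous_intros holomorphic_on_imp_continuous_on hol) auto

lemma A_diff_le:
  assumes "k \<in> {1..<p}" "x \<in> ball 0 1" "y \<in> ball 0 1"
  shows "cmod (A k y - A k x) \<le> \<Lambda> k * cmod (y - x)"
proof (rule field_differentiable_bound[of "ball 0 1" "A k" "deriv (A k)"])
  fix z :: complex assume "z \<in> ball 0 1"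
  then show "(A k has_field_derivative deriv (A k) z) (at z within ball 0 1)"
    using assms(1) by (intro has_field_derivative_at_within[OF has_deriv_A]) auto
qed (use assms deriv_A_le in auto)

lemma A_le: "k \<in> {1..<p} \<Longrightarrow> z \<in> ball 0 1 \<Longrightarrow> cmod (A k z) \<le> \<Lambda> k * cmod z"
  using A_diff_le[of k 0 z] A_0[of k] by simp

lemma H_diff_le:
  assumes "cmod x \<le> r" "cmod y \<le> r" "r < 1"
  shows "cmod (H y - H x) \<le> (\<Sum>k\<in>{1..<p}. (real k + 1) * \<Lambda> k * r ^ k) * cmod (y - x)"
proof -
  have "cmod (H y - H x) \<le> (\<Sum>k\<in>{1..<p}. cmod (cnj y ^ k * A k y - cnj x ^ k * A k x))"
    unfolding H_def sum_subtractf[symmetric] by (rule norm_sum)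
  also have "\<dots> \<le> (\<Sum>k\<in>{1..<p}. (real k + 1) * \<Lambda> k * r ^ k * cmod (y - x))"
    using assms \<Lambda>_nonneg A_le A_diff_le
    by (intro sum_mono cnj_power_mult_diff_le) auto
  finally show ?thesis by (simp add: sum_distrib_right)
qed

text \<open>Estimating \<open>H z\<close> directly gives the coefficients \<open>\<Lambda> k\<close>
  of \<open>landau_sigma\<close>; \<open>H_diff_le\<close> with \<open>x = 0\<close> would give
  \<open>(k + 1) * \<Lambda> k\<close>.\<close>

lemma H_le:
  assumes "z \<in> ball 0 1"
  shows "cmod (H z) \<le> (\<Sum>k\<in>{1..<p}. \<Lambda> k * cmod z ^ (k + 1))"
proof -
  have "cmod (cnj z ^ k * A k z) \<le> cmod z ^ k * (\<Lambda> k * cmod z)" if "k \<in> {1..<p}" for k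
    unfolding norm_mult norm_power using A_le[OF that assms] by (auto intro!: mult_left_mono)
  then show ?thesis
    unfolding H_def by (intro order_trans[OF norm_sum] sum_mono) (simp add: algebra_simps)
qed

lemma Schwarz_Pick_deriv_A0:
  assumes "z \<in> ball 0 1"
  shows "\<Lambda> 0 * cmod (deriv (A 0) z - 1) \<le> cmod z * cmod (of_real ((\<Lambda> 0)\<^sup>2) - deriv (A 0) z)"
  using hol[of 0] p by (intro Schwarz_Pick_at_1 holomorphic_deriv \<Lambda>0 deriv_A0_less deriv_A0_0 assms) auto

lemma Schwarz_Pick_deriv_A0_le:
  assumes "cmod z \<le> r" "r < 1"
  shows "\<Lambda> 0 * cmod (deriv (A 0) z - 1) \<le> r * cmod (of_real ((\<Lambda> 0)\<^sup>2) - deriv (A 0) z)"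
  using Schwarz_Pick_deriv_A0[of z] assms
    mult_right_mono[OF assms(1) norm_ge_zero[of "of_real ((\<Lambda> 0)\<^sup>2) - deriv (A 0) z"]]
  by simp

lemma Re_deriv_A0_ge:
  assumes "cmod z \<le> r" "r < 1"
  shows "\<Lambda> 0 * ((1 - \<Lambda> 0 * r) / (\<Lambda> 0 - r)) \<le> Re (deriv (A 0) z)"
proof -
  have "0 \<le> r" using assms(1) norm_ge_zero order_trans by blast
  then show ?thesis
    using Schwarz_Pick_deriv_A0_le[OF assms] assms(2) \<Lambda>0
    by (intro pseudohyperbolic_disk_Re_ge)
qed

text \<open>On the convex set \<open>cball 0 r\<close> the real part of the derivative of
  \<open>A 0\<close> is at least the main term, so \<open>A 0\<close> expands distances by that
  factor; the Lipschitz constant of \<open>H\<close> is then subtracted.\<close>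

lemma F_diff_ge:
  assumes "cmod x \<le> r" "cmod y \<le> r" "r < 1"
  shows "landau_lhs p \<Lambda> r * cmod (y - x) \<le> cmod (F y - F x)"
proof (cases "x = y")
  case False
  have "\<Lambda> 0 * ((1 - \<Lambda> 0 * r) / (\<Lambda> 0 - r)) * (cmod (y - x))\<^sup>2
      \<le> Re ((A 0 y - A 0 x) * cnj (y - x))"
    using assms p
    by (intro Re_diff_ge_of_Re_deriv_ge[of "cball 0 r" _ _ _ "deriv (A 0)"] has_deriv_A Re_deriv_A0_ge) auto
  also have "\<dots> \<le> cmod (A 0 y - A 0 x) * cmod (y - x)"
    by (metis complex_Re_le_cmod complex_mod_cnj norm_mult)
  finally have "\<Lambda> 0 * ((1 - \<Lambda> 0 * r) / (\<Lambda> 0 - r)) * cmod (y - x) * cmod (y - x)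
      \<le> cmod (A 0 y - A 0 x) * cmod (y - x)"
    by (simp only: power2_eq_square mult.assoc)
  then have "\<Lambda> 0 * ((1 - \<Lambda> 0 * r) / (\<Lambda> 0 - r)) * cmod (y - x) \<le> cmod (A 0 y - A 0 x)"
    by (rule mult_right_le_imp_le) (use False in simp)
  moreover have "cmod (A 0 y - A 0 x) \<le> cmod (F y - F x) + cmod (H y - H x)"
    using norm_triangle_ineq4[of "F y - F x" "H y - H x"] by (simp add: F_eq)
  ultimately show ?thesis
    using H_diff_le[OF assms] by (simp add: landau_lhs_def left_diff_distrib del: times_divide_eq_right)
qed simp

text \<open>Along the ray to \<open>z\<close> the bound for the derivative of \<open>A 0\<close> is
  used at each radius \<open>t * |z|\<close> separately and integrated to \<open>M\<close>. A
  uniform bound, as in \<open>F_diff_ge\<close>, would be too weak.\<close>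

lemma F_ge_landau_sigma:
  assumes z: "z \<in> ball 0 1"
  shows "landau_sigma p \<Lambda> (cmod z) \<le> cmod (F z)"
proof (cases "z = 0")
  case False
  define M where "M = (\<lambda>r. (\<Lambda> 0)\<^sup>2 * r + ((\<Lambda> 0) ^ 3 - \<Lambda> 0) * ln (1 - r / \<Lambda> 0))"
  \<comment> \<open>The summand \<open>0\<close> keeps the shape \<open>x + of_real t * d\<close> of
    \<open>DERIV_Re_along_line\<close>.\<close>
  define \<phi> where "\<phi> = (\<lambda>t. Re (A 0 (0 + of_real t * z) * cnj z) - M (t * cmod z) * cmod z)"
  have "\<phi> 0 \<le> \<phi> 1"
  proof (rule DERIV_nonneg_imp_nondecreasing[where f = \<phi>])
    fix t :: real assume t: "0 \<le> t" "t \<le> 1"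
    have c: "cmod (0 + of_real t * z) = t * cmod z" using t by (simp add: norm_mult)
    have "t * cmod z \<le> 1 * cmod z" using t by (intro mult_right_mono) auto
    then have t1: "t * cmod z < 1" using z by simp
    have "((\<lambda>t. M (t * cmod z)) has_real_derivative
        \<Lambda> 0 * ((1 - \<Lambda> 0 * (t * cmod z)) / (\<Lambda> 0 - t * cmod z)) * (1 * cmod z)) (at t)"
      unfolding M_def using t1
      by (intro DERIV_chain2[OF DERIV_landau_main_term_primitive] DERIV_cmult_right DERIV_ident) simp
    then have "(\<phi> has_real_derivative (cmod z)\<^sup>2 * Re (deriv (A 0) (0 + of_real t * z))
        - \<Lambda> 0 * ((1 - \<Lambda> 0 * (t * cmod z)) / (\<Lambda> 0 - t * cmod z)) * (1 * cmod z) * cmod z) (at t)"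
      unfolding \<phi>_def using c t1 p
      by (intro DERIV_diff DERIV_Re_along_line has_deriv_A DERIV_cmult_right) auto
    moreover have "0 \<le> (cmod z)\<^sup>2 * Re (deriv (A 0) (0 + of_real t * z))
        - \<Lambda> 0 * ((1 - \<Lambda> 0 * (t * cmod z)) / (\<Lambda> 0 - t * cmod z)) * (1 * cmod z) * cmod z"
      using mult_left_mono[OF Re_deriv_A0_ge[of "0 + of_real t * z" "t * cmod z"], of "(cmod z)\<^sup>2"]
        c t1 by (simp add: power2_eq_square mult_ac del: times_divide_eq_right)
    ultimately show "\<exists>y. (\<phi> has_real_derivative y) (at t) \<and> 0 \<le> y" by blast
  qed simp
  then have "M (cmod z) * cmod z \<le> Re (A 0 z * cnj z)"
    using A_0[of 0] p by (simp add: \<phi>_def M_def)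
  also have "\<dots> \<le> cmod (A 0 z) * cmod z"
    by (metis complex_Re_le_cmod complex_mod_cnj norm_mult)
  finally have "M (cmod z) \<le> cmod (A 0 z)" using False by simp
  moreover have "cmod (A 0 z) \<le> cmod (F z) + cmod (H z)"
    using norm_triangle_ineq4[of "F z" "H z"] by (simp add: F_eq)
  ultimately show ?thesis
    using H_le[OF z] by (simp add: M_def landau_sigma_def)
qed (simp add: landau_sigma_0)

text \<open>The derivative of \<open>A 0\<close> stays within distance \<open>1\<close> of
  \<open>1\<close>, whence \<open>|A 0 z| < 2\<close>. By the defining equation the Lipschitz
  constant of \<open>H\<close> equals the main term at \<open>\<rho>\<close>, which is at most its
  value \<open>1\<close> at \<open>0\<close>.\<close>

lemma F_less_3:
  assumes \<rho>: "\<rho> \<le> 1 / \<Lambda> 0" "landau_lhs p \<Lambda> \<rho> = 0" and z: "cmod z < \<rho>"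
  shows "cmod (F z) < 3"
proof -
  have "1 / \<Lambda> 0 < 1" using \<Lambda>0 by simp
  then have \<rho>1: "\<rho> < 1" using \<rho> by simp
  have \<rho>0: "0 < \<rho>" using z norm_ge_zero le_less_trans by blast
  have "cmod (A 0 z - A 0 0) \<le> 2 * cmod (z - 0)"
  proof (rule field_differentiable_bound[of "cball 0 (cmod z)" "A 0" "deriv (A 0)"])
    fix x :: complex assume x: "x \<in> cball 0 (cmod z)"
    then have "cmod (deriv (A 0) x - 1) \<le> 1"
      using \<rho> z \<rho>1 \<Lambda>0
      by (intro pseudohyperbolic_disk_near_1[OF \<Lambda>0 \<rho>(1)] Schwarz_Pick_deriv_A0_le) auto
    then show "cmod (deriv (A 0) x) \<le> 2"
      using norm_triangle_ineq[of "deriv (A 0) x - 1" 1] by simp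
    show "(A 0 has_field_derivative deriv (A 0) x) (at x within cball 0 (cmod z))"
      using x z \<rho>1 p by (intro has_field_derivative_at_within[OF has_deriv_A]) auto
  qed auto
  then have "cmod (A 0 z) < 2" using A_0[of 0] p z \<rho>1 by simp
  moreover have "cmod (H z) \<le> 1"
  proof -
    have "(\<Sum>k\<in>{1..<p}. (real k + 1) * \<Lambda> k * \<rho> ^ k) = \<Lambda> 0 * ((1 - \<Lambda> 0 * \<rho>) / (\<Lambda> 0 - \<rho>))"
      using \<rho>(2) by (simp add: landau_lhs_def)
    also have "\<dots> \<le> 1"
      using landau_main_term_strict_antimono[of 0 \<rho>] \<rho>0 \<rho>1 \<Lambda>0 by simp
    finally have "(\<Sum>k\<in>{1..<p}. (real k + 1) * \<Lambda> k * \<rho> ^ k) * cmod (z - 0) \<le> 1 * 1"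
      using z \<rho>1 by (intro mult_mono) auto
    then show ?thesis
      using H_diff_le[of 0 \<rho> z] z \<rho>0 \<rho>1 H_0 by simp
  qed
  ultimately show ?thesis
    using norm_triangle_ineq[of "A 0 z" "H z"] by (simp add: F_eq)
qed

lemma inj_on_F:
  assumes \<rho>: "\<rho> < 1" "landau_lhs p \<Lambda> \<rho> = 0"
  shows "inj_on F (ball 0 \<rho>)"
proof (rule inj_onI, rule ccontr)
  fix x y assume xy: "x \<in> ball 0 \<rho>" "y \<in> ball 0 \<rho>" "F x = F y" "x \<noteq> y"
  \<comment> \<open>This radius is strictly below the root, so \<open>landau_lhs\<close> is still
    positive there; at \<open>\<rho>\<close> itself the estimate is void.\<close>
  define r where "r = max (cmod x) (cmod y)"
  have r: "0 \<le> r" "r < \<rho>" using xy by (auto simp: r_def max_def)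
  have "0 < landau_lhs p \<Lambda> r"
    using landau_lhs_strict_antimono[of r \<rho>] r \<rho> by simp
  moreover have "landau_lhs p \<Lambda> r * cmod (y - x) \<le> cmod (F y - F x)"
    using r \<rho> by (intro F_diff_ge) (auto simp: r_def)
  ultimately show False using xy by (simp add: mult_le_0_iff)
qed

lemma inj_on_exp_F:
  assumes \<rho>: "\<rho> \<le> 1 / \<Lambda> 0" "landau_lhs p \<Lambda> \<rho> = 0"
  shows "inj_on (\<lambda>z. exp (F z)) (ball 0 \<rho>)"
proof (rule inj_onI)
  fix x y assume xy: "x \<in> ball 0 \<rho>" "y \<in> ball 0 \<rho>" "exp (F x) = exp (F y)"
  have "1 / \<Lambda> 0 < 1" using \<Lambda>0 by simp
  then have \<rho>1: "\<rho> < 1" using \<rho> by simp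
  have "\<bar>Im (F z)\<bar> < pi" if "z \<in> ball 0 \<rho>" for z
    using F_less_3[OF \<rho>, of z] abs_Im_le_cmod[of "F z"] pi_gt3 that by simp
  from this[OF xy(1)] this[OF xy(2)] have "\<bar>Im (F x) - Im (F y)\<bar> < 2 * pi"
    by linarith
  then have "F x = F y"
    using xy(3) by (rule exp_complex_eqI)
  then show "x = y"
    using inj_on_F[OF \<rho>1 \<rho>(2)] xy by (auto dest: inj_onD)
qed

lemma landau_conclusion_exp_F:
  assumes \<rho>: "0 < \<rho>" "\<rho> \<le> 1 / \<Lambda> 0" "landau_lhs p \<Lambda> \<rho> = 0"
    and f: "\<And>z. z \<in> ball 0 1 \<Longrightarrow> f z = exp (F z)"
  shows "landau_conclusion p \<Lambda> \<rho> f"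
proof -
  have "1 / \<Lambda> 0 < 1" using \<Lambda>0 by simp
  then have \<rho>1: "\<rho> < 1" using \<rho> by simp
  define \<sigma> where "\<sigma> = landau_sigma p \<Lambda> \<rho>"
  have \<sigma>: "0 < \<sigma>"
    using landau_sigma_strict_mono[of 0 \<rho> \<rho>] \<rho> \<rho>1 by (simp add: \<sigma>_def landau_sigma_0)
  have sub: "ball 0 \<rho> \<subseteq> ball 0 1" "cball 0 \<rho> \<subseteq> ball 0 1" using \<rho>1 by auto
  have f\<rho>: "f z = exp (F z)" if "z \<in> ball 0 \<rho>" for z using that sub f by blast
  have inj: "inj_on f (ball 0 \<rho>)"
    using inj_on_exp_F[OF \<rho>(2,3)] by (simp add: inj_on_def f\<rho>)
  have cover: "ball 0 \<sigma> \<subseteq> F ` ball 0 \<rho>"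
    using continuous_on_subset[OF continuous_on_F sub(2)] inj_on_F[OF \<rho>1 \<rho>(3)] F_0 \<rho>(1)
  proof (rule inj_on_ball_image_supset)
    fix z assume "cmod z = \<rho>"
    then show "\<sigma> \<le> cmod (F z)" using F_ge_landau_sigma[of z] \<rho>1 by (simp add: \<sigma>_def)
  qed
  have "continuous_on (ball 0 \<rho>) f"
    using continuous_on_subset[OF continuous_on_F sub(1)]
    by (subst continuous_on_cong[OF refl f\<rho>]) (auto intro: continuous_intros)
  then obtain g where g: "homeomorphism (ball 0 \<rho>) (f ` ball 0 \<rho>) f g"
    using invariance_of_domain_homeomorphism[OF open_ball _ _ inj] by auto
  define D where "D = ball (complex_of_real (cosh \<sigma>)) (sinh \<sigma>)"
  have D: "D \<subseteq> f ` ball 0 \<rho>"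
  proof
    fix w assume "w \<in> D"
    then have w: "0 < Re w" "cmod (Ln w) < \<sigma>"
      using ball_cosh_sinh_subset[OF \<sigma>] by (auto simp: D_def)
    then obtain z where z: "z \<in> ball 0 \<rho>" "F z = Ln w" using cover by force
    have "w \<noteq> 0" using w by auto
    then have "w = f z" using z f\<rho> by simp
    then show "w \<in> f ` ball 0 \<rho>" using z by blast
  qed
  have fgD: "f ` g ` D = D"
    using homeomorphism_apply2[OF g] D by (force simp: image_image)
  have gD: "g ` D \<subseteq> ball 0 \<rho>" using homeomorphism_image2[OF g] D by blast
  have contg: "continuous_on D g"
    using homeomorphism_cont2[OF g] D continuous_on_subset by blast
  have "inj_on g D"
    using homeomorphism_apply2[OF g] D by (intro inj_on_inverseI[of _ f]) auto
  then have "open (g ` D)"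
    using contg by (intro invariance_of_domain) (auto simp: D_def)
  moreover have "connected (g ` D)"
    using contg by (intro connected_continuous_image) (auto simp: D_def)
  ultimately have "schlicht_disk_in f (ball 0 \<rho>) (of_real (cosh \<sigma>)) (sinh \<sigma>)"
    unfolding schlicht_disk_in_def using gD fgD inj_on_subset[OF inj gD] \<sigma>
    by (intro conjI exI[of _ "g ` D"]) (auto simp: D_def)
  then show ?thesis using inj by (simp add: landau_conclusion_def \<sigma>_def)
qed

end

section \<open>Poly-analytic functions and holomorphic branches\<close>

text \<open>The values of the derivative at \<open>1\<close> and \<open>\<i>\<close> are
  \<open>a + b\<close> and \<open>\<i> * (a - b)\<close>.\<close>

lemma wirt_eq:
  assumes "(F has_derivative (\<lambda>h. a * h + b * cnj h)) (at z)"
  shows "wirt_z F z = a" "wirt_zbar F z = b"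
proof -
  have "frechet_derivative F (at z) = (\<lambda>h. a * h + b * cnj h)"
    using frechet_derivative_at[OF assms] by simp
  then show "wirt_z F z = a" "wirt_zbar F z = b"
    by (simp_all add: wirt_z_def wirt_zbar_def algebra_simps)
qed

text \<open>Agreement of \<open>F\<close> with the sum is asked on \<open>D\<close> only, because
  the iterates of \<open>wirt_zbar\<close> are known only there.\<close>

lemma has_derivative_log_series:
  assumes D: "open D" and z: "z \<in> D" and B: "\<And>k. k < q \<Longrightarrow> B k holomorphic_on D"
    and F: "\<And>w. w \<in> D \<Longrightarrow> F w = log_series q B w"
  shows "(F has_derivative (\<lambda>h. (\<Sum>k<q. cnj z ^ k * deriv (B k) z) * h +
           (\<Sum>k<q. of_nat k * cnj z ^ (k - 1) * B k z) * cnj h)) (at z)"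
proof -
  have summand: "((\<lambda>w. cnj w ^ k * B k w) has_derivative
      (\<lambda>h. cnj z ^ k * (deriv (B k) z * h) + (of_nat k * (cnj h * cnj z ^ (k - 1))) * B k z)) (at z)"
    if "k < q" for k
  proof (rule has_derivative_mult)
    show "((\<lambda>w. cnj w ^ k) has_derivative (\<lambda>h. of_nat k * (cnj h * cnj z ^ (k - 1)))) (at z)"
      by (auto intro!: derivative_eq_intros simp: mult_ac)
    show "(B k has_derivative (\<lambda>h. deriv (B k) z * h)) (at z)"
      using holomorphic_derivI[OF B[OF that] D z] by (simp add: has_field_derivative_def)
  qed
  have "(log_series q B has_derivative (\<lambda>h. \<Sum>k<q. cnj z ^ k * (deriv (B k) z * h) +
      (of_nat k * (cnj h * cnj z ^ (k - 1))) * B k z)) (at z)"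
    unfolding log_series_def[abs_def] by (rule has_derivative_sum) (use summand in auto)
  also have "(\<lambda>h. \<Sum>k<q. cnj z ^ k * (deriv (B k) z * h) + (of_nat k * (cnj h * cnj z ^ (k - 1))) * B k z)
      = (\<lambda>h. (\<Sum>k<q. cnj z ^ k * deriv (B k) z) * h +
           (\<Sum>k<q. of_nat k * cnj z ^ (k - 1) * B k z) * cnj h)"
    by (simp add: sum_distrib_left sum_distrib_right sum.distrib mult_ac)
  finally show ?thesis
    using D z F[symmetric] by (rule has_derivative_transform_within_open)
qed

text \<open>Induction on the length: \<open>wirt_zbar\<close> removes the term \<open>k = 0\<close>
  and replaces the coefficients by \<open>(k + 1) * B (k + 1)\<close>.\<close>

lemma poly_analytic_on_log_series:
  assumes D: "open D" and B: "\<And>k. k < q \<Longrightarrow> B k holomorphic_on D"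
    and F: "\<And>w. w \<in> D \<Longrightarrow> F w = log_series q B w"
  shows "poly_analytic_on q F D"
  using B F
proof (induction q arbitrary: F B)
  case 0
  then have "continuous_on D F \<longleftrightarrow> continuous_on D (\<lambda>z. 0 :: complex)"
    by (intro continuous_on_cong) (auto simp: log_series_def)
  then show ?case using 0 by (simp add: poly_analytic_on_def log_series_def)
next
  case (Suc q)
  note der = has_derivative_log_series[OF D _ Suc.prems]
  have "poly_analytic_on q (wirt_zbar F) D"
  proof (rule Suc.IH)
    show "(\<lambda>z. of_nat (Suc k) * B (Suc k) z) holomorphic_on D" if "k < q" for k
      using Suc.prems(1)[of "Suc k"] that by (intro holomorphic_intros) auto
    show "wirt_zbar F w = log_series q (\<lambda>k z. of_nat (Suc k) * B (Suc k) z) w" if "w \<in> D" for w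
      using wirt_eq(2)[OF der[OF that]]
      by (simp add: log_series_def sum.lessThan_Suc_shift mult_ac del: sum.lessThan_Suc)
  qed
  moreover have diff: "F differentiable at z" if "z \<in> D" for z
    using der[OF that] unfolding differentiable_def by blast
  moreover have "continuous_on D F"
    by (intro continuous_at_imp_continuous_on ballI differentiable_imp_continuous_within diff)
  ultimately show ?case
    \<comment> \<open>\<open>funpow_Suc_right\<close> peels off the innermost derivative, so the
      iterates become those of \<open>wirt_zbar F\<close>.\<close>
    by (auto simp: poly_analytic_on_def less_Suc_eq_0_disj funpow_Suc_right simp del: funpow.simps)
qed

text \<open>Vanishing of the conjugate derivative is the Cauchy--Riemann equation
  \<open>L' \<i> = \<i> * L' 1\<close>, which makes the real derivative complex linear.\<close>

lemma poly_analytic_on_1_imp_holomorphic_on: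
  assumes "open D" "poly_analytic_on 1 L D"
  shows "L holomorphic_on D"
  unfolding holomorphic_on_open[OF assms(1)]
proof
  fix z assume "z \<in> D"
  then have "L differentiable at z" and zbar: "wirt_zbar L z = 0"
    using assms by (auto simp: poly_analytic_on_def)
  define L' where "L' = frechet_derivative L (at z)"
  have L': "(L has_derivative L') (at z)"
    using \<open>L differentiable at z\<close> by (simp add: L'_def frechet_derivative_works)
  interpret bounded_linear L' by (rule has_derivative_bounded_linear[OF L'])
  define c where "c = L' 1"
  have "\<i> * (c + \<i> * L' \<i>) = 0"
    using zbar by (simp add: wirt_zbar_def L'_def c_def)
  then have i: "L' \<i> = \<i> * c"
    by (simp add: algebra_simps)
  have "L' h = c * h" for h
  proof -
    have "L' h = L' (Re h *\<^sub>R 1 + Im h *\<^sub>R \<i>)"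
      by (rule arg_cong[of _ _ L']) (simp add: complex_eq_iff)
    also have "\<dots> = Re h *\<^sub>R c + Im h *\<^sub>R (\<i> * c)"
      by (simp only: add scaleR i c_def[symmetric])
    also have "\<dots> = c * h"
      by (simp add: complex_eq_iff algebra_simps)
    finally show ?thesis .
  qed
  then have "L' = (*) c" by (rule ext)
  then have "(L has_field_derivative c) (at z)"
    using L' by (simp add: has_field_derivative_def)
  then show "\<exists>f'. (L has_field_derivative f') (at z)" ..
qed

text \<open>The difference of the two branches is continuous and its distinct values are at least
  \<open>2 * pi\<close> apart, so it is constant on the connected set.\<close>

lemma log_branch_on_holomorphic_on:
  assumes D: "connected D" and M: "log_branch_on D f M" "M holomorphic_on D"
    and L: "log_branch_on D f L"
  shows "L holomorphic_on D"
proof -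
  have e: "exp (L z) = exp (M z)" if "z \<in> D" for z
    using M L that by (simp add: log_branch_on_def)
  have "(\<lambda>z. L z - M z) constant_on D"
  proof (rule continuous_discrete_range_constant[OF D])
    show "continuous_on D (\<lambda>z. L z - M z)"
      using M L by (intro continuous_intros) (auto simp: log_branch_on_def)
    fix x assume x: "x \<in> D"
    have "2 * pi \<le> cmod (L y - M y - (L x - M x))"
      if y: "y \<in> D" and ne: "L y - M y \<noteq> L x - M x" for y
    proof (rule ccontr)
      assume "\<not> ?thesis"
      then have "\<bar>Im (L y - M y) - Im (L x - M x)\<bar> < 2 * pi"
        using abs_Im_le_cmod[of "L y - M y - (L x - M x)"] by simp
      moreover have "exp (L y - M y) = exp (L x - M x)"
        using e[OF x] e[OF y] by (simp add: exp_diff)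
      ultimately show False using ne exp_complex_eqI by blast
    qed
    then show "\<exists>e>0. \<forall>y. y \<in> D \<and> L y - M y \<noteq> L x - M x \<longrightarrow> e \<le> cmod (L y - M y - (L x - M x))"
      by (intro exI[of _ "2 * pi"]) auto
  qed
  then obtain c where c: "\<And>z. z \<in> D \<Longrightarrow> L z - M z = c" by (auto simp: constant_on_def)
  have "(\<lambda>z. M z + c) holomorphic_on D"
    using M by (intro holomorphic_intros)
  then show ?thesis
    by (rule holomorphic_transform) (use c in force)
qed

lemma landau_class_mono: "M \<subseteq> N \<Longrightarrow> landau_class N p \<Lambda> a A f \<Longrightarrow> landau_class M p \<Lambda> a A f"
  unfolding landau_class_def by blast

lemma landau_class_log_series:
  "landau_class N p \<Lambda> a A f \<Longrightarrow> z \<in> ball 0 1 \<Longrightarrow> f z = exp (log_series p A z)"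
  by (simp add: landau_class_def log_series_def exp_sum)

text \<open>Log-analyticity yields some holomorphic branch, and \<open>A k\<close> differs from it
  by a constant. As \<open>a 0 = exp (A 0)\<close> and \<open>A 0 0 = 0\<close>, the chain rule
  identifies the derivatives of \<open>a 0\<close> and \<open>A 0\<close> at the origin.\<close>

lemma landau_logs_of_landau_class:
  assumes p: "1 \<le> p" and "landau_bounds p \<Lambda>" and cls: "landau_class {0} p \<Lambda> a A f"
  shows "landau_logs p \<Lambda> A"
proof -
  have hol: "A k holomorphic_on ball 0 1" if k: "k < p" for k
  proof -
    obtain M where "log_branch_on (ball 0 1) (a k) M" "poly_analytic_on 1 M (ball 0 1)"
      using cls k unfolding landau_class_def log_p_analytic_on_def by blast
    moreover have "log_branch_on (ball 0 1) (a k) (A k)"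
      using cls k unfolding landau_class_def by blast
    ultimately show ?thesis
      using poly_analytic_on_1_imp_holomorphic_on log_branch_on_holomorphic_on
      by (meson connected_ball open_ball)
  qed
  have A0: "A k 0 = 0" if "k < p" for k
    using cls that by (simp add: landau_class_def)
  have "(A 0 has_field_derivative deriv (A 0) 0) (at 0)"
    using holomorphic_derivI[OF hol open_ball, of 0 0 UNIV] p by simp
  then have "((\<lambda>z. exp (A 0 z)) has_field_derivative exp (A 0 0) * deriv (A 0) 0) (at 0)"
    by (intro DERIV_fun_exp)
  moreover have "exp (A 0 z) = a 0 z" if "z \<in> ball 0 1" for z
    using cls p that unfolding landau_class_def log_branch_on_def by auto
  ultimately have "(a 0 has_field_derivative exp (A 0 0) * deriv (A 0) 0) (at 0)"
    using has_field_derivative_transform_within_open[of _ _ 0 "ball 0 1" "a 0"] by auto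
  then have "deriv (a 0) 0 = deriv (A 0) 0"
    using A0[of 0] p by (simp add: DERIV_imp_deriv)
  then have "deriv (A 0) 0 = 1"
    using cls by (simp add: landau_class_def)
  then show ?thesis
    using assms hol A0
    by (auto simp: landau_logs_def landau_logs_axioms_def landau_class_def)
qed

lemma landau_conclusion_of_landau_class:
  assumes "1 \<le> p" "landau_bounds p \<Lambda>" "landau_class {0} p \<Lambda> a A f"
    and "0 < \<rho>" "\<rho> \<le> 1 / \<Lambda> 0" "landau_lhs p \<Lambda> \<rho> = 0"
  shows "landau_conclusion p \<Lambda> \<rho> f"
  using landau_logs.landau_conclusion_exp_F[OF landau_logs_of_landau_class] assms
    landau_class_log_series by metis

section \<open>The extremal function\<close>

context landau_bounds
begin

text \<open>The case \<open>k = 0\<close> is the primitive of the main term with \<open>Ln\<close>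
  in place of \<open>ln\<close>. The minus signs for \<open>k > 0\<close> make
  \<open>F_ge_landau_sigma\<close> an equality on the positive radius up to the root.\<close>

definition extremal_log :: "nat \<Rightarrow> complex \<Rightarrow> complex" where
  "extremal_log k z = (if k = 0
     then of_real ((\<Lambda> 0)\<^sup>2) * z + of_real ((\<Lambda> 0) ^ 3 - \<Lambda> 0) * Ln (1 - z / of_real (\<Lambda> 0))
     else - of_real (\<Lambda> k) * z)"

definition extremal :: "complex \<Rightarrow> complex" where
  "extremal z = exp (log_series p extremal_log z)"

lemma has_deriv_extremal_log_0:
  assumes z: "z \<in> ball 0 1"
  shows "(extremal_log 0 has_field_derivative
    of_real (\<Lambda> 0) * (1 - of_real (\<Lambda> 0) * z) / (of_real (\<Lambda> 0) - z)) (at z)"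
proof -
  have Lz: "cmod (z / of_real (\<Lambda> 0)) < 1"
    using z \<Lambda>0 by (simp add: norm_divide divide_less_eq)
  \<comment> \<open>This keeps the argument of \<open>Ln\<close> in the right half-plane, off the
    branch cut.\<close>
  then have "Re (z / of_real (\<Lambda> 0)) < 1"
    using complex_Re_le_cmod le_less_trans by blast
  then have "1 - z / of_real (\<Lambda> 0) \<notin> \<real>\<^sub>\<le>\<^sub>0"
    by (auto simp: complex_nonpos_Reals_iff simp del: Re_divide_of_real)
  moreover have nz: "of_real (\<Lambda> 0) - z \<noteq> 0" "complex_of_real (\<Lambda> 0) \<noteq> 0"
    using z \<Lambda>0 by auto
  ultimately have "(extremal_log 0 has_field_derivative
      of_real ((\<Lambda> 0)\<^sup>2) * 1 + of_real ((\<Lambda> 0) ^ 3 - \<Lambda> 0) *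
        (inverse (1 - z / of_real (\<Lambda> 0)) * (0 - 1 / of_real (\<Lambda> 0)))) (at z)"
    unfolding extremal_log_def[abs_def] if_P[OF refl]
    by (intro DERIV_add DERIV_cmult DERIV_ident DERIV_chain2[OF has_field_derivative_Ln]
        DERIV_diff DERIV_const DERIV_cdivide)
  moreover have "of_real ((\<Lambda> 0)\<^sup>2) * 1 + of_real ((\<Lambda> 0) ^ 3 - \<Lambda> 0) *
        (inverse (1 - z / of_real (\<Lambda> 0)) * (0 - 1 / of_real (\<Lambda> 0)))
      = of_real (\<Lambda> 0) * (1 - of_real (\<Lambda> 0) * z) / (of_real (\<Lambda> 0) - z)"
    using nz by (simp add: divide_simps) (simp add: power2_eq_square power3_eq_cube algebra_simps)
  ultimately show ?thesis by metis
qed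

lemma has_deriv_extremal_log_pos:
  "k > 0 \<Longrightarrow> (extremal_log k has_field_derivative - of_real (\<Lambda> k)) (at z)"
  unfolding extremal_log_def[abs_def] by (auto intro!: derivative_eq_intros)

lemma extremal_log_holomorphic_on: "extremal_log k holomorphic_on ball 0 1"
  unfolding holomorphic_on_open[OF open_ball]
  using has_deriv_extremal_log_0 has_deriv_extremal_log_pos by (cases "k = 0") blast+

lemma extremal_log_at_0: "extremal_log k 0 = 0"
  by (simp add: extremal_log_def)

text \<open>The map \<open>(1 - L z) / (L - z)\<close> with \<open>L = \<Lambda> 0\<close> sends the
  unit disk into itself: the squared moduli of denominator and numerator differ by
  \<open>(L^2 - 1) (1 - |z|^2)\<close>.\<close>

lemma deriv_extremal_log_0_less:
  assumes z: "z \<in> ball 0 1"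
  shows "cmod (deriv (extremal_log 0) z) < \<Lambda> 0"
proof -
  have "1 < \<Lambda> 0 * \<Lambda> 0" using \<Lambda>0 by (simp add: less_1_mult)
  moreover have "(cmod z)\<^sup>2 < 1" using z by (simp add: power_less_one_iff)
  ultimately have "0 < (\<Lambda> 0 * \<Lambda> 0 - 1) * (1 - (cmod z)\<^sup>2)" by simp
  also have "\<dots> = (cmod (of_real (\<Lambda> 0) - z))\<^sup>2 - (cmod (1 - of_real (\<Lambda> 0) * z))\<^sup>2"
    by (simp add: cmod_power2) (simp add: power2_eq_square algebra_simps)
  finally have "(cmod (1 - of_real (\<Lambda> 0) * z))\<^sup>2 < (cmod (of_real (\<Lambda> 0) - z))\<^sup>2"
    by (simp only: diff_gt_0_iff_gt)
  then have less: "cmod (1 - of_real (\<Lambda> 0) * z) < cmod (of_real (\<Lambda> 0) - z)"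
    by (rule power2_less_imp_less) (rule norm_ge_zero)
  have "cmod (deriv (extremal_log 0) z)
      = \<Lambda> 0 * (cmod (1 - of_real (\<Lambda> 0) * z) / cmod (of_real (\<Lambda> 0) - z))"
    using \<Lambda>0 DERIV_imp_deriv[OF has_deriv_extremal_log_0[OF z]] by (simp add: norm_mult norm_divide)
  also have "\<dots> < \<Lambda> 0 * 1"
    using \<Lambda>0 less le_less_trans[OF norm_ge_zero less] by (intro mult_strict_left_mono) auto
  finally show ?thesis by simp
qed

lemma lambda_min_extremal:
  assumes "1 \<le> p"
  shows "lambda_min extremal 0 = 1"
proof -
  have p: "{..<p} = insert 0 {1..<p}" using assms by auto
  have "(log_series p extremal_log has_derivative
      (\<lambda>h. (\<Sum>k<p. cnj 0 ^ k * deriv (extremal_log k) 0) * h +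
           (\<Sum>k<p. of_nat k * cnj 0 ^ (k - 1) * extremal_log k 0) * cnj h)) (at 0)"
    by (rule has_derivative_log_series[of "ball 0 1"]) (auto intro: extremal_log_holomorphic_on)
  moreover have "deriv (extremal_log 0) 0 = 1"
    using DERIV_imp_deriv[OF has_deriv_extremal_log_0[of 0]] \<Lambda>0 by simp
  then have "(\<Sum>k<p. cnj 0 ^ k * deriv (extremal_log k) 0) = 1"
    unfolding p by (simp add: power_0_left)
  \<comment> \<open>In the second sum the term \<open>k = 1\<close> carries
    \<open>cnj 0 ^ 0 = 1\<close>; it vanishes because \<open>extremal_log 1 0 = 0\<close>.\<close>
  ultimately have "(log_series p extremal_log has_derivative (\<lambda>h. 1 * h + 0 * cnj h)) (at 0)"
    by (simp add: extremal_log_at_0)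
  then have "(extremal has_derivative
      (\<lambda>h. exp (log_series p extremal_log 0) * (1 * h + 0 * cnj h))) (at 0)"
    unfolding extremal_def[abs_def]
    by (rule has_derivative_compose[OF _ DERIV_exp[unfolded has_field_derivative_def]])
  then have "(extremal has_derivative (\<lambda>h. 1 * h + 0 * cnj h)) (at 0)"
    by (simp add: log_series_def extremal_log_at_0)
  from wirt_eq[OF this] show ?thesis by (simp add: lambda_min_def)
qed

lemma landau_class_extremal:
  assumes p: "1 \<le> p"
  shows "landau_class {0} p \<Lambda> (\<lambda>k z. exp (extremal_log k z)) extremal_log extremal"
  unfolding landau_class_def
proof (intro conjI ballI allI impI)
  have cont: "continuous_on (ball 0 1) (log_series p extremal_log)"
    unfolding log_series_def[abs_def]
    by (intro continuous_intros holomorphic_on_imp_continuous_on extremal_log_holomorphic_on)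
  show "log_p_analytic_on p extremal (ball 0 1)"
    unfolding log_p_analytic_on_def log_branch_on_def
    using cont poly_analytic_on_log_series[OF open_ball extremal_log_holomorphic_on refl]
    by (intro exI[of _ "log_series p extremal_log"]) (simp add: extremal_def)
  show "extremal z = (\<Prod>k<p. exp (cnj z ^ k * extremal_log k z))" for z
    by (simp add: extremal_def log_series_def exp_sum)
  show "extremal 0 = 1"
    by (simp add: extremal_def log_series_def extremal_log_at_0)
  show "lambda_min extremal 0 = 1"
    using p by (rule lambda_min_extremal)
  show branch: "log_branch_on (ball 0 1) (\<lambda>z. exp (extremal_log k z)) (extremal_log k)" for k
    by (simp add: log_branch_on_def holomorphic_on_imp_continuous_on extremal_log_holomorphic_on)
  show "log_p_analytic_on 1 (\<lambda>z. exp (extremal_log k z)) (ball 0 1)" for k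
    unfolding log_p_analytic_on_def
    using branch poly_analytic_on_log_series[OF open_ball, of 1 "\<lambda>_. extremal_log k" 0 1 "extremal_log k"]
    by (intro exI[of _ "extremal_log k"]) (auto simp: log_series_def extremal_log_holomorphic_on)
  show "exp (extremal_log k 0) = 1" for k
    by (simp add: extremal_log_at_0)
  show "extremal_log k 0 = Ln (exp (extremal_log k 0))" for k
    by (simp add: extremal_log_at_0)
  show "deriv (\<lambda>z. exp (extremal_log k z)) 0 = 1" if "k \<in> {0}" for k
    using that DERIV_imp_deriv[OF DERIV_fun_exp[OF has_deriv_extremal_log_0[of 0]]] \<Lambda>0
    by (simp add: extremal_log_at_0)
  show "cmod (deriv (extremal_log 0) z) < \<Lambda> 0" if "z \<in> ball 0 1" for z
    using that by (rule deriv_extremal_log_0_less)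
  show "cmod (deriv (extremal_log k) z) \<le> \<Lambda> k" if "k \<in> {1..<p}" for k z
    using that \<Lambda>_nonneg DERIV_imp_deriv[OF has_deriv_extremal_log_pos[of k z]] by auto
qed

text \<open>The argument of \<open>Ln\<close> is a positive real and
  \<open>cnj x ^ k * x = x ^ (k + 1)\<close>, so the series reduces to the real formula.\<close>

lemma extremal_of_real:
  assumes p: "1 \<le> p" and x: "x \<le> 1"
  shows "extremal (of_real x) = of_real (exp (landau_sigma p \<Lambda> x))"
proof -
  have s: "{..<p} = insert 0 {1..<p}" using p by auto
  have "0 < 1 - x / \<Lambda> 0" using x \<Lambda>0 by simp
  then have "Ln (1 - of_real x / of_real (\<Lambda> 0)) = of_real (ln (1 - x / \<Lambda> 0))"
    using Ln_of_real[of "1 - x / \<Lambda> 0"] by simp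
  then have "log_series p extremal_log (of_real x) = of_real (landau_sigma p \<Lambda> x)"
    unfolding log_series_def s
    by (simp add: extremal_log_def landau_sigma_def sum_negf mult_ac)
  then show ?thesis by (simp add: extremal_def exp_of_real)
qed

lemma extremal_not_inj:
  assumes p: "1 \<le> p" and \<rho>: "0 < \<rho>" "\<rho> < 1" "landau_lhs p \<Lambda> \<rho> = 0" and r: "\<rho> < r"
  shows "\<not> inj_on extremal (ball 0 r)"
proof
  assume inj: "inj_on extremal (ball 0 r)"
  \<comment> \<open>As \<open>r\<close> may exceed \<open>1\<close>, the two points are sought below
    a smaller radius inside the unit interval.\<close>
  obtain s where s: "\<rho> < s" "s < min r 1" using dense[of \<rho> "min r 1"] \<rho> r by auto
  obtain x y where xy: "0 \<le> x" "x < y" "y \<le> s" "landau_sigma p \<Lambda> x = landau_sigma p \<Lambda> y"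
    using landau_sigma_not_inj[of \<rho> s] \<rho> s by auto
  have "extremal (of_real x) = extremal (of_real y)"
    using extremal_of_real[OF p] xy s by simp
  moreover have "complex_of_real x \<in> ball 0 r" "complex_of_real y \<in> ball 0 r"
    using xy s by auto
  ultimately have "complex_of_real x = of_real y" by (rule inj_onD[OF inj])
  then show False using xy by simp
qed

text \<open>A larger disk would contain \<open>e\<^sup>\<sigma>\<close>, the limit of \<open>extremal x\<close> as \<open>x\<close> increases to \<open>\<rho>\<close>. Were it
  the value at an interior point \<open>z\<close>, continuity of the inverse would give \<open>z = \<rho>\<close>.\<close>

lemma extremal_schlicht_disk_le:
  assumes p: "1 \<le> p" and \<rho>: "0 < \<rho>" "\<rho> < 1" and inj: "inj_on extremal (ball 0 \<rho>)"
    and disk: "schlicht_disk_in extremal (ball 0 \<rho>) (of_real (cosh (landau_sigma p \<Lambda> \<rho>))) r"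
  shows "r \<le> \<bar>sinh (landau_sigma p \<Lambda> \<rho>)\<bar>"
proof (rule ccontr)
  define \<sigma> where "\<sigma> = landau_sigma p \<Lambda> \<rho>"
  assume "\<not> ?thesis"
  then have r: "\<bar>sinh \<sigma>\<bar> < r" by (simp add: \<sigma>_def)
  \<comment> \<open>Hence \<open>exp \<sigma>\<close> has distance \<open>|sinh \<sigma>|\<close>
    from the centre and lies in any larger disk.\<close>
  have "exp \<sigma> = cosh \<sigma> + sinh \<sigma>" by (simp add: cosh_plus_sinh)
  then have "of_real (exp \<sigma>) \<in> ball (complex_of_real (cosh \<sigma>)) r"
    using r by (simp only: mem_ball dist_of_real) (simp add: dist_real_def)
  then obtain z where z: "z \<in> ball 0 \<rho>" "extremal z = of_real (exp \<sigma>)"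
    using disk unfolding schlicht_disk_in_def \<sigma>_def by (metis imageE subsetD)
  have cont: "continuous_on (ball 0 \<rho>) extremal"
    unfolding extremal_def[abs_def] log_series_def[abs_def] using \<rho>
    by (intro continuous_intros holomorphic_on_imp_continuous_on
        holomorphic_on_subset[OF extremal_log_holomorphic_on]) auto
  obtain g where g: "homeomorphism (ball 0 \<rho>) (extremal ` ball 0 \<rho>) extremal g"
    using invariance_of_domain_homeomorphism[OF open_ball cont _ inj] by auto
  have ev: "\<forall>\<^sub>F x in at_left \<rho>. 0 < x \<and> x < \<rho>"
    using eventually_at_left_real[OF \<rho>(1)] by eventually_elim auto
  have "(landau_sigma p \<Lambda> \<longlongrightarrow> \<sigma>) (at_left \<rho>)"
    using DERIV_isCont[OF DERIV_landau_sigma[of \<rho>]] \<rho>(2)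
    by (simp add: \<sigma>_def isCont_def filterlim_at_split)
  then have "((\<lambda>x. complex_of_real (exp (landau_sigma p \<Lambda> x))) \<longlongrightarrow> extremal z) (at_left \<rho>)"
    unfolding z(2) by (intro tendsto_intros)
  moreover have "\<forall>\<^sub>F x in at_left \<rho>. complex_of_real (exp (landau_sigma p \<Lambda> x)) = extremal (of_real x)"
    using ev by eventually_elim (use extremal_of_real[OF p] \<rho> in auto)
  ultimately have "((\<lambda>x. extremal (of_real x)) \<longlongrightarrow> extremal z) (at_left \<rho>)"
    by (rule Lim_transform_eventually)
  moreover have "\<forall>\<^sub>F x in at_left \<rho>. extremal (of_real x) \<in> extremal ` ball 0 \<rho>"
    using ev by eventually_elim auto
  ultimately have "((\<lambda>x. g (extremal (of_real x))) \<longlongrightarrow> g (extremal z)) (at_left \<rho>)"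
    by (intro continuous_on_tendsto_compose[OF homeomorphism_cont2[OF g] _ imageI[OF z(1)]])
  moreover have "\<forall>\<^sub>F x in at_left \<rho>. g (extremal (of_real x)) = of_real x"
    using ev by eventually_elim (auto intro!: homeomorphism_apply1[OF g])
  ultimately have "((\<lambda>x. complex_of_real x) \<longlongrightarrow> g (extremal z)) (at_left \<rho>)"
    by (rule Lim_transform_eventually)
  moreover have "((\<lambda>x. complex_of_real x) \<longlongrightarrow> of_real \<rho>) (at_left \<rho>)"
    by (intro tendsto_intros)
  ultimately have "g (extremal z) = of_real \<rho>"
    using tendsto_unique trivial_limit_at_left_real by blast
  then have "z = of_real \<rho>"
    using homeomorphism_apply1[OF g z(1)] by simp
  then show False using z \<rho> by simp
qed

end

theorem theorem5:
  fixes p :: nat and \<Lambda> :: "nat \<Rightarrow> real"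
  assumes "p \<ge> 1" and "\<Lambda> 0 > 1" and "\<forall>k\<in>{1..<p}. \<Lambda> k \<ge> 0"
  shows "\<exists>\<rho>\<^sub>1. 0 < \<rho>\<^sub>1 \<and> \<rho>\<^sub>1 < 1 \<and> landau_lhs p \<Lambda> \<rho>\<^sub>1 = 0 \<and>
           (\<forall>r. 0 < r \<and> r < 1 \<and> landau_lhs p \<Lambda> r = 0 \<longrightarrow> r = \<rho>\<^sub>1) \<and>
           (\<forall>a A f. landau_class {..<p} p \<Lambda> a A f \<longrightarrow>
              inj_on f (ball 0 \<rho>\<^sub>1) \<and>
              (let \<sigma>\<^sub>1 = landau_sigma p \<Lambda> \<rho>\<^sub>1
               in schlicht_disk_in f (ball 0 \<rho>\<^sub>1) (of_real (cosh \<sigma>\<^sub>1)) (sinh \<sigma>\<^sub>1))) \<and>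
           landau_sharp p \<Lambda> \<rho>\<^sub>1"
proof -
  interpret landau_bounds p \<Lambda>
    using assms by unfold_locales auto
  obtain \<rho> where \<rho>: "0 < \<rho>" "\<rho> \<le> 1 / \<Lambda> 0" "landau_lhs p \<Lambda> \<rho> = 0"
    by (rule landau_lhs_root)
  have "1 / \<Lambda> 0 < 1" using assms(2) by simp
  then have \<rho>1: "\<rho> < 1" using \<rho>(2) by simp
  have unique: "r = \<rho>" if "0 < r" "r < 1" "landau_lhs p \<Lambda> r = 0" for r
    using landau_lhs_strict_antimono[of r \<rho>] landau_lhs_strict_antimono[of \<rho> r] \<rho> \<rho>1 that
    by (cases r \<rho> rule: linorder_cases) auto
  have concl: "landau_conclusion p \<Lambda> \<rho> f" if "landau_class {0} p \<Lambda> a A f" for a A f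
    using landau_conclusion_of_landau_class[OF assms(1) landau_bounds_axioms that \<rho>] .
  \<comment> \<open>Imposing the normalization on all indices gives a subclass of the one with
    \<open>N = {0}\<close>, since \<open>p >= 1\<close>.\<close>
  have "landau_class {0} p \<Lambda> a A f" if "landau_class {..<p} p \<Lambda> a A f" for a A f
    using assms(1) by (intro landau_class_mono[OF _ that]) auto
  then have main: "landau_conclusion p \<Lambda> \<rho> f" if "landau_class {..<p} p \<Lambda> a A f" for a A f
    using concl that by blast
  note ext = landau_class_extremal[OF assms(1)]
  have inj: "inj_on extremal (ball 0 \<rho>)"
    using concl[OF ext] by (simp add: landau_conclusion_def)
  \<comment> \<open>Positivity removes the absolute value in
    \<open>extremal_schlicht_disk_le\<close>.\<close>
  have "0 < landau_sigma p \<Lambda> \<rho>"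
    using landau_sigma_strict_mono[of 0 \<rho> \<rho>] \<rho> \<rho>1 by (simp add: landau_sigma_0)
  then have "\<not> schlicht_disk_in extremal (ball 0 \<rho>) (of_real (cosh (landau_sigma p \<Lambda> \<rho>))) r"
    if "r > sinh (landau_sigma p \<Lambda> \<rho>)" for r
    using extremal_schlicht_disk_le[OF assms(1) \<rho>(1) \<rho>1 inj, of r] that by auto
  then have "landau_sharp p \<Lambda> \<rho>"
    unfolding landau_sharp_def
    using concl ext extremal_not_inj[OF assms(1) \<rho>(1) \<rho>1 \<rho>(3)] by blast
  then show ?thesis
    using \<rho> \<rho>1 unique main unfolding landau_conclusion_def Let_def by blast
qed

end
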